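(* Let $x_0>0$ and let $\phi$ be a function on $[x_0,\infty)$ satisfying Assumption 1 (stated in the context). Let $Y\sim G$ be a random variable with values in $\mathbb{R}_+=[0,\infty)$ having finite moments of all positive integer orders, and let $G$ be absolutely continuous on $\mathbb{R}_{+,x_0}=[x_0,\infty)$ with density $G'(x)=g(x)>0$ on $\mathbb{R}_{+,x_0}$. Assume that $$\lim_{x\to\infty}\frac{\phi(x)}{x}=0\quad\text{and}\quad \limsup_{x\to\infty}\frac{g((x+\phi(x))^2)}{g(x^2)}<1.$$ Then the moments of $Y$ satisfy Carleman's condition $$\sum_{n=1}^{\infty}\left(\mathsf{E}[Y^{n}]\right)^{-1/(2n)}=\infty,$$ and hence $Y$ is M-det on $\mathbb{R}_+$.
   Context: $Y\sim G$ means that the random variable $Y$ has distribution (function) $G$. The distribution $G$ is arbitrary on $[0,x_0)$; only its restriction to $[x_0,\infty)$ is assumed absolutely continuous. M-determinacy: a random variable with values in $\mathbb{R}_+$ and finite moments of all orders is M-det (moment-determinate) on $\mathbb{R}_+$ if no probability distribution on $\mathbb{R}_+$ other than its own has the same moment sequence (moments of all orders $n\in\mathbb{N}=\{1,2,\ldots\}$). Assumption 1 on $\phi$: $\phi$ is a non-negative differentiable function on $[x_0,\infty)$, with $x_0>0$; the function $y=y(x)=x+\phi(x)$ is strictly increasing in $x$, with inverse function $x(y)$ on $[y_0,\infty)$, where $y_0=y(x_0)$; and the function $\varphi(y)=y-x(y)$ satisfies, for some constants $C_+>0$ and $y_*\ge y_0$: (a) $\varphi'(y)\in[0,1]$ for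 $y\ge y_*$; (b) $\varphi(y)\le C_+\log y$ for $y\ge y_*$; (c) $y\,\varphi'(y)\le C_+$ for $y\ge y_*$. *)

theory Defs
  imports "HOL-Probability.Probability"
begin

text \<open>
  The inverse of \<open>x \<mapsto> x + \<phi> x\<close> on \<open>[x0, \<infinity>)\<close>. It is only meaningful on the image of \<open>[x0, \<infinity>)\<close>,
  which is \<open>[x0 + \<phi> x0, \<infinity>)\<close> for the functions considered below.
\<close>
definition shift_inverse :: "real \<Rightarrow> (real \<Rightarrow> real) \<Rightarrow> real \<Rightarrow> real" where
  "shift_inverse x0 \<phi> = the_inv_into {x0..} (\<lambda>x. x + \<phi> x)"

definition dual_shift :: "real \<Rightarrow> (real \<Rightarrow> real) \<Rightarrow> real \<Rightarrow> real" where
  "dual_shift x0 \<phi> y = y - shift_inverse x0 \<phi> y"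

text \<open>
  Derivatives are taken within \<open>[y0, \<infinity>)\<close>, so they are one-sided at the end point \<open>y0\<close> and
  two-sided elsewhere; \<open>\<phi>\<close> and its dual have no meaning to the left of the end points.
\<close>
definition admissible_shift :: "real \<Rightarrow> (real \<Rightarrow> real) \<Rightarrow> bool" where
  "admissible_shift x0 \<phi> \<longleftrightarrow>
     (\<forall>x\<ge>x0. 0 \<le> \<phi> x) \<and>
     \<phi> differentiable_on {x0..} \<and>
     strict_mono_on {x0..} (\<lambda>x. x + \<phi> x) \<and>
     (let y0 = x0 + \<phi> x0; \<psi> = dual_shift x0 \<phi> in
      \<exists>C>0. \<exists>ystar\<ge>y0. \<exists>\<psi>'. \<forall>y\<ge>ystar.
        (\<psi> has_real_derivative \<psi>' y) (at y within {y0..}) \<and>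
        \<psi>' y \<in> {0..1} \<and>
        \<psi> y \<le> C * ln y \<and>
        y * \<psi>' y \<le> C)"

text \<open>
  The restriction of the distribution \<open>D\<close> to \<open>[x0, \<infinity>)\<close> is absolutely continuous with respect to
  Lebesgue measure, with density (any version) \<open>g\<close>; nothing is said about \<open>D\<close> below \<open>x0\<close>.
\<close>
definition has_density_from :: "real measure \<Rightarrow> real \<Rightarrow> (real \<Rightarrow> real) \<Rightarrow> bool" where
  "has_density_from D x0 g \<longleftrightarrow>
     g \<in> borel_measurable (restrict_space borel {x0..}) \<and>
     restrict_space D {x0..} = density (restrict_space lborel {x0..}) (\<lambda>x. ennreal (g x))"

definition nonneg_distribution_with_moments :: "real measure \<Rightarrow> bool" where
  "nonneg_distribution_with_moments D \<longleftrightarrow>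
     real_distribution D \<and> (AE x in D. 0 \<le> x) \<and> (\<forall>n\<ge>1. integrable D (\<lambda>x. x ^ n))"

text \<open>Moment determinacy on the half-line (the Stieltjes sense).\<close>
definition M_det_nonneg :: "real measure \<Rightarrow> bool" where
  "M_det_nonneg D \<longleftrightarrow>
     nonneg_distribution_with_moments D \<and>
     (\<forall>D'. nonneg_distribution_with_moments D' \<longrightarrow>
           (\<forall>n\<ge>1. (LINT x|D'. x ^ n) = (LINT x|D. x ^ n)) \<longrightarrow> D' = D)"

end

theory Submission
  imports Defs
begin

text \<open>
  Two independent facts are combined. The first is a growth bound on the moments, which gives
  Carleman's condition; the second is Carleman's theorem on the half-line, which turns the
  condition into determinacy.

  Growth. Put \<open>t = y\<^sup>2\<close>. The limit superior says that the density, read at squares, loses a factor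
  \<open>q < 1\<close> whenever its argument moves from \<open>x\<close> to \<open>y = x + \<phi> x\<close>, and the bounds on the dual shift
  say that this move is at most logarithmic: the inverse \<open>\<xi>\<close> satisfies \<open>y - \<xi> y \<le> C ln y\<close> and
  \<open>y (1 - \<xi>' y) \<le> C\<close>. Substituting \<open>u = (\<xi> (sqrt t))\<^sup>2\<close> in a tail of \<open>\<integral> u^n g u du\<close> turns
  \<open>u^n du\<close> into \<open>\<xi>' y (\<xi> y / y)^(2 n + 1) t^n dt\<close>. By Bernoulli's inequality the factor in front of
  \<open>t^n\<close> is at least \<open>1 - \<epsilon>\<close> once \<open>y \<ge> b = K (n + 2) ln (n + 2)\<close>, while the density gains \<open>1 / q\<close>. So the tail beyond \<open>(\<xi> b)\<^sup>2\<close> is at least \<open>(1 - \<epsilon>) / q > 1\<close> times the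
  tail beyond \<open>b\<^sup>2\<close> (\<open>tail_integral_comparison\<close>). The two differ by at most \<open>b^(2 n)\<close>, because the
  total mass is one, hence both are \<open>O(b^(2 n))\<close> and so is the \<open>n\<close>-th moment (\<open>moment_growth\<close>). Its
  power \<open>-1 / (2 n)\<close> is then at least a constant times \<open>1 / (n ln n)\<close>, whose sum diverges.

  Determinacy. Let two distributions on the half-line have the same moments \<open>m n\<close>, and let \<open>F\<close> be half
  the difference of their transforms \<open>E cos (t sqrt Y)\<close>. The cosine is the right kernel: it is the
  characteristic function of \<open>sqrt Y\<close> with a random sign, so its even derivatives at \<open>0\<close> are, up to
  sign, the moments of \<open>Y\<close> and its odd ones vanish. Thus \<open>F\<close> is flat at \<open>0\<close>. Its derivatives are
  bounded by the averages \<open>M n\<close> of the two values of \<open>E (sqrt Y)^n\<close>, a log-convex sequence with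
  \<open>M (2 n) = m n\<close>. Carleman's inequality for geometric means shows that Carleman's condition makes
  \<open>\<Sum> M n / M (n + 1)\<close> diverge, and then Bang's argument for the Denjoy-Carleman theorem
  (\<open>bang_quasianalytic\<close>) gives \<open>F = 0\<close>. Levy's uniqueness theorem identifies the distributions.
\<close>

section \<open>Carleman's inequality for geometric means\<close>

lemma carleman_weight_prod:
  "(\<Prod>k\<le>n. real (k + 2) ^ (k + 1) / real (k + 1) ^ k) = real (n + 2) ^ (n + 1)"
proof (induction n)
  case (Suc n)
  have "(\<Prod>k\<le>Suc n. real (k + 2) ^ (k + 1) / real (k + 1) ^ k)
      = real (n + 2) ^ (n + 1) * (real (n + 3) ^ (n + 2) / real (n + 2) ^ (n + 1))"
    using Suc.IH by (simp add: eval_nat_numeral)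
  then show ?case by (simp add: eval_nat_numeral)
qed simp

text \<open>
  The classical proof: the weights \<open>c k\<close> are chosen so that \<open>c 0 \<cdots> c n = (n + 2)^(n + 1)\<close>. The geometric
  mean of the \<open>a k * c k\<close> is then \<open>n + 2\<close> times that of the \<open>a k\<close>, and after the inequality of the
  means the coefficients \<open>1 / ((n + 1) (n + 2))\<close> telescope.
\<close>
theorem carleman_inequality:
  fixes a :: "nat \<Rightarrow> real"
  assumes nonneg: "\<And>k. 0 \<le> a k" and "summable a"
  shows "summable (\<lambda>n. (\<Prod>k\<le>n. a k) powr (1 / real (Suc n)))"
proof (rule summableI_nonneg_bounded)
  let ?G = "\<lambda>n. (\<Prod>k\<le>n. a k) powr (1 / real (Suc n))"
  define c where "c k = real (k + 2) ^ (k + 1) / real (k + 1) ^ k" for k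
  have c_nonneg: "0 \<le> c k" for k by (simp add: c_def)
  have mean: "?G n \<le> (\<Sum>k\<le>n. a k * c k) * (1 / real (n + 1) - 1 / real (n + 2))" for n
  proof -
    have "(\<Prod>k\<le>n. a k * c k) powr (1 / real (Suc n)) = ?G n * real (n + 2)"
    proof -
      have "(\<Prod>k\<le>n. c k) powr (1 / real (Suc n)) = real (n + 2)"
        by (simp only: c_def carleman_weight_prod)
           (simp add: powr_realpow [symmetric] powr_powr del: power_Suc)
      then show ?thesis
        by (simp add: prod.distrib powr_mult prod_nonneg nonneg c_nonneg)
    qed
    moreover have "(\<Prod>k\<le>n. a k * c k) powr (1 / real (Suc n)) \<le> (\<Sum>k\<le>n. a k * c k / real (Suc n))"
      using arith_geom_mean[of "{..n}" "\<lambda>k. a k * c k"] nonneg c_nonneg by simp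
    ultimately have "?G n * real (n + 2) \<le> (\<Sum>k\<le>n. a k * c k) / real (n + 1)"
      by (simp add: sum_divide_distrib)
    then have "?G n \<le> (\<Sum>k\<le>n. a k * c k) / real (n + 1) / real (n + 2)"
      by (subst pos_le_divide_eq) auto
    also have "\<dots> = (\<Sum>k\<le>n. a k * c k) * (1 / real (n + 1) - 1 / real (n + 2))"
      by (simp add: field_simps)
    finally show ?thesis .
  qed
  have c_le: "c k / real (k + 1) \<le> exp 1" for k
  proof -
    have "c k / real (k + 1) = (real (k + 2) / real (k + 1)) ^ (k + 1)"
      by (simp only: c_def power_divide power_add power_one_right divide_divide_eq_left times_divide_times_eq)
    also have "\<dots> = (1 + 1 / real (k + 1)) ^ (k + 1)"
      by (rule arg_cong[where f = "\<lambda>x. x ^ (k + 1)"]) (simp add: field_simps)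
    also have "\<dots> \<le> exp (1 / real (k + 1)) ^ (k + 1)"
      by (intro power_mono exp_ge_add_one_self) auto
    also have "\<dots> = exp 1"
      by (simp only: exp_of_nat_mult [symmetric]) simp
    finally show ?thesis .
  qed
  show "0 \<le> ?G n" for n by simp
  show "(\<Sum>n<N. ?G n) \<le> exp 1 * suminf a" for N
  proof -
    let ?f = "\<lambda>n k. a k * c k * (1 / real (n + 1) - 1 / real (n + 2))"
    have "(\<Sum>n<N. ?G n) \<le> (\<Sum>n<N. \<Sum>k\<le>n. ?f n k)"
      using mean by (intro sum_mono) (simp add: sum_distrib_right)
    also have "\<dots> = (\<Sum>n<N. \<Sum>k\<in>{k \<in> {..<N}. k \<le> n}. ?f n k)"
      by (intro sum.cong) auto
    also have "\<dots> = (\<Sum>k<N. \<Sum>n\<in>{n \<in> {..<N}. k \<le> n}. ?f n k)"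
      by (rule sum.swap_restrict) auto
    also have "\<dots> = (\<Sum>k<N. \<Sum>n\<in>{k..<N}. ?f n k)"
      by (intro sum.cong) auto
    also have "\<dots> \<le> (\<Sum>k<N. exp 1 * a k)"
    proof (rule sum_mono)
      fix k assume "k \<in> {..<N}"
      then have "k \<le> N" by simp
      have "(\<Sum>n\<in>{k..<N}. 1 / real (n + 1) - 1 / real (n + 2)) = 1 / real (k + 1) - 1 / real (N + 1)"
        using sum_Suc_diff'[OF \<open>k \<le> N\<close>, of "\<lambda>n. - 1 / real (n + 1)"] by simp
      also have "\<dots> \<le> 1 / real (k + 1)" by simp
      finally have "a k * c k * (\<Sum>n\<in>{k..<N}. 1 / real (n + 1) - 1 / real (n + 2))
          \<le> a k * c k * (1 / real (k + 1))"
        using nonneg c_nonneg by (intro mult_left_mono) auto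
      also have "\<dots> \<le> a k * exp 1"
        using mult_left_mono[OF c_le nonneg, of k k] by simp
      finally show "(\<Sum>n\<in>{k..<N}. a k * c k * (1 / real (n + 1) - 1 / real (n + 2))) \<le> exp 1 * a k"
        by (simp add: sum_distrib_left mult.commute)
    qed
    also have "\<dots> \<le> exp 1 * suminf a"
      using assms by (simp add: sum_distrib_left [symmetric] sum_le_suminf)
    finally show ?thesis .
  qed
qed

section \<open>Bang's quasi-analyticity theorem\<close>

text \<open>
  Log-convexity means that the ratios of consecutive terms increase.
\<close>
lemma log_convex_power_bound:
  fixes M :: "nat \<Rightarrow> real"
  assumes pos: "\<And>n. 0 < M n" and logconv: "\<And>n. (M (Suc n))\<^sup>2 \<le> M n * M (Suc (Suc n))"
    and "n + k \<le> Suc N"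
  shows "M (n + k) \<le> M n * (M (Suc N) / M N) ^ k"
proof -
  have "M (Suc n) / M n \<le> M (Suc (Suc n)) / M (Suc n)" for n
    using logconv[of n] pos[of n] pos[of "Suc n"] by (simp add: field_simps power2_eq_square)
  then have mono: "mono (\<lambda>n. M (Suc n) / M n)" by (rule mono_iff_le_Suc[THEN iffD2, rule_format])
  show ?thesis using assms(3)
  proof (induction k)
    case (Suc k)
    have "M (Suc (n + k)) / M (n + k) \<le> M (Suc N) / M N"
      using monoD[OF mono, of "n + k" N] Suc.prems by simp
    then have "M (Suc (n + k)) \<le> M (n + k) * (M (Suc N) / M N)"
      using pos[of "n + k"] by (simp add: field_simps)
    also have "\<dots> \<le> (M n * (M (Suc N) / M N) ^ k) * (M (Suc N) / M N)"
      using Suc pos by (intro mult_right_mono) (auto intro!: divide_nonneg_nonneg less_imp_le)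
    finally show ?case by (simp add: mult_ac)
  qed auto
qed

text \<open>
  The functions \<open>F n\<close> play the role of the derivatives of \<open>F 0\<close>; all that is used about them is Taylor's
  inequality. The hypothesis \<open>near\<close> may be called smallness at level \<open>N + 1\<close>, the conclusion smallness at
  level \<open>N\<close>. By log-convexity, Taylor's formula of order \<open>N + 1 - n\<close> at a point whose distance
  \<open>\<bar>h\<bar>\<close> is at most \<open>M N / (e M (N + 1))\<close> is dominated by the exponential series at \<open>1\<close>, so that a
  single factor \<open>e\<close> is lost.
\<close>
lemma bang_step:
  fixes F :: "nat \<Rightarrow> real \<Rightarrow> real" and M :: "nat \<Rightarrow> real"
  assumes pos: "\<And>n. 0 < M n" and logconv: "\<And>n. (M (Suc n))\<^sup>2 \<le> M n * M (Suc (Suc n))"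
    and taylor: "\<And>n m x h. \<bar>F n (x + h) - (\<Sum>k<m. F (n + k) x * h ^ k / fact k)\<bar>
                    \<le> M (n + m) * \<bar>h\<bar> ^ m / fact m"
    and near: "\<And>n. n \<le> Suc N \<Longrightarrow> \<bar>F n x\<bar> \<le> exp (real n - real (Suc N)) * M n"
    and h: "exp 1 * \<bar>h\<bar> \<le> M N / M (Suc N)"
    and "n \<le> N"
  shows "\<bar>F n (x + h)\<bar> \<le> exp (real n - real N) * M n"
proof -
  define m where "m = Suc N - n"
  define \<rho> where "\<rho> = M (Suc N) / M N"
  define u where "u = exp 1 * \<rho> * \<bar>h\<bar>"
  have \<rho>: "0 < \<rho>" using pos by (simp add: \<rho>_def)
  have nm: "n + m = Suc N" using \<open>n \<le> N\<close> by (simp add: m_def)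
  have u: "0 \<le> u" "u \<le> 1"
    using h pos[of N] pos[of "Suc N"] by (simp_all add: u_def \<rho>_def field_simps)
  let ?t = "\<lambda>k. exp (real (n + k) - real (Suc N)) * M (n + k) * \<bar>h\<bar> ^ k / fact k"
  have "\<bar>F n (x + h)\<bar> \<le> \<bar>\<Sum>k<m. F (n + k) x * h ^ k / fact k\<bar> + M (n + m) * \<bar>h\<bar> ^ m / fact m"
    using taylor[of n x h m] by linarith
  also have "\<dots> \<le> (\<Sum>k<m. ?t k) + ?t m"
  proof (intro add_mono order.trans[OF sum_abs] sum_mono)
    fix k assume "k \<in> {..<m}"
    then have "\<bar>F (n + k) x\<bar> \<le> exp (real (n + k) - real (Suc N)) * M (n + k)"
      using nm by (intro near) auto
    then show "\<bar>F (n + k) x * h ^ k / fact k\<bar> \<le> ?t k"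
      by (simp add: abs_mult power_abs divide_right_mono mult_right_mono)
  qed (simp add: nm)
  also have "\<dots> = (\<Sum>k\<le>m. ?t k)" by (simp add: lessThan_Suc_atMost [symmetric])
  also have "\<dots> \<le> (\<Sum>k\<le>m. exp (real n - real (Suc N)) * M n * (u ^ k / fact k))"
  proof (rule sum_mono)
    fix k assume "k \<in> {..m}"
    then have "M (n + k) \<le> M n * \<rho> ^ k"
      unfolding \<rho>_def using nm by (intro log_convex_power_bound[where M = M, OF pos logconv]) auto
    moreover have "exp (real (n + k) - real (Suc N)) = exp (real n - real (Suc N)) * exp 1 ^ k"
      by (simp add: exp_of_nat_mult [symmetric] exp_add [symmetric])
    ultimately have "?t k \<le> exp (real n - real (Suc N)) * exp 1 ^ k * (M n * \<rho> ^ k) * \<bar>h\<bar> ^ k / fact k"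
      by (simp only:) (intro divide_right_mono mult_right_mono mult_left_mono, auto)
    also have "\<dots> = exp (real n - real (Suc N)) * M n * (u ^ k / fact k)"
      by (simp add: u_def power_mult_distrib)
    finally show "?t k \<le> exp (real n - real (Suc N)) * M n * (u ^ k / fact k)" .
  qed
  also have "\<dots> = exp (real n - real (Suc N)) * M n * (\<Sum>k\<le>m. u ^ k / fact k)"
    by (simp add: sum_distrib_left)
  also have "\<dots> \<le> exp (real n - real (Suc N)) * M n * exp 1"
  proof (rule mult_left_mono)
    have "(\<Sum>k\<le>m. u ^ k / fact k) \<le> exp u"
      unfolding exp_def using u summable_exp_generic[of u]
      by (simp add: divide_inverse mult.commute) (intro sum_le_suminf, auto)
    also have "\<dots> \<le> exp 1" using u by simp
    finally show "(\<Sum>k\<le>m. u ^ k / fact k) \<le> exp 1" .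
  qed (use pos[of n] in auto)
  also have "\<dots> = exp (real n - real N) * M n"
    by (simp add: exp_diff exp_add field_simps)
  finally show ?thesis .
qed

text \<open>
  At the flat point smallness in the sense of \<open>bang_step\<close> holds at every level. Going down from
  level \<open>N + j\<close> to level \<open>N\<close> one may walk the distance \<open>\<Sum> M i / (e M (i + 1))\<close>, summed over
  \<open>N \<le> i < N + j\<close>; by divergence this reaches any given \<open>x\<close> however large \<open>N\<close> is, and level \<open>N\<close> at
  \<open>x\<close> bounds \<open>F 0 x\<close> by \<open>exp (- N) * M 0\<close>.
\<close>
theorem bang_quasianalytic:
  fixes F :: "nat \<Rightarrow> real \<Rightarrow> real" and M :: "nat \<Rightarrow> real"
  assumes pos: "\<And>n. 0 < M n" and logconv: "\<And>n. (M (Suc n))\<^sup>2 \<le> M n * M (Suc (Suc n))"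
    and taylor: "\<And>n m x h. \<bar>F n (x + h) - (\<Sum>k<m. F (n + k) x * h ^ k / fact k)\<bar>
                    \<le> M (n + m) * \<bar>h\<bar> ^ m / fact m"
    and diverges: "\<not> summable (\<lambda>n. M n / M (Suc n))"
    and flat: "\<And>n. F n a = 0"
  shows "F 0 x = 0"
proof -
  define r where "r i = exp (-1) * (M i / M (Suc i))" for i
  have r: "0 \<le> r i" for i using pos by (simp add: r_def less_imp_le)
  have reach: "\<bar>F n y\<bar> \<le> exp (real n - real N) * M n"
    if "\<bar>y - a\<bar> \<le> (\<Sum>i\<in>{N..<N + j}. r i)" "n \<le> N" for j N n y
    using that
  proof (induction j arbitrary: N n y)
    case 0
    then show ?case using flat pos[of n] by (simp add: less_imp_le)
  next
    case (Suc j)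
    define S where "S = (\<Sum>i\<in>{Suc N..<Suc N + j}. r i)"
    have S: "0 \<le> S" by (simp add: S_def r sum_nonneg)
    have split: "\<bar>y - a\<bar> \<le> r N + S"
    proof -
      have "(\<Sum>i\<in>{N..<N + Suc j}. r i) = r N + S"
        by (subst sum.atLeast_Suc_lessThan) (auto simp: S_def)
      then show ?thesis using Suc.prems(1) by simp
    qed
    \<comment> \<open>A point between \<open>a\<close> and \<open>y\<close> that the induction hypothesis reaches and from which one step
    leads to \<open>y\<close>.\<close>
    define y' where "y' = (if \<bar>y - a\<bar> \<le> S then y else a + sgn (y - a) * S)"
    have y': "\<bar>y' - a\<bar> \<le> S" "\<bar>y - y'\<bar> \<le> r N"
      using S split r[of N] by (auto simp: y'_def sgn_real_def abs_if split: if_splits)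
    have "\<bar>F n (y' + (y - y'))\<bar> \<le> exp (real n - real N) * M n"
    proof (rule bang_step[where F = F and M = M, OF pos logconv taylor])
      show "\<bar>F i y'\<bar> \<le> exp (real i - real (Suc N)) * M i" if "i \<le> Suc N" for i
        using y'(1) that by (intro Suc.IH) (auto simp: S_def)
      show "exp 1 * \<bar>y - y'\<bar> \<le> M N / M (Suc N)"
      proof -
        have "exp 1 * \<bar>y - y'\<bar> \<le> exp 1 * r N" using y'(2) by simp
        also have "\<dots> = M N / M (Suc N)"
          by (simp only: r_def mult.assoc [symmetric] exp_add [symmetric]) simp
        finally show ?thesis .
      qed
    qed (use Suc.prems in auto)
    then show ?case by simp
  qed
  have "\<not> summable r" using diverges unfolding r_def by (subst summable_cmult_iff) simp
  have unbounded: "\<exists>j. c \<le> (\<Sum>i\<in>{N..<N + j}. r i)" for c N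
  proof (rule ccontr)
    assume "\<not> ?thesis"
    then have *: "(\<Sum>i\<in>{N..<N + j}. r i) \<le> c" for j by (simp add: not_le less_imp_le)
    have "summable (\<lambda>i. r (i + N))"
    proof (rule summableI_nonneg_bounded)
      show "(\<Sum>i<j. r (i + N)) \<le> c" for j
        using *[of j] sum.shift_bounds_nat_ivl[of r 0 N j]
        by (simp only: lessThan_atLeast0 add_0_left add.commute[of j N])
    qed (rule r)
    then show False using \<open>\<not> summable r\<close> by (simp add: summable_iff_shift)
  qed
  have bound: "\<bar>F 0 x\<bar> \<le> exp (- real N) * M 0" for N
  proof -
    obtain j where "\<bar>x - a\<bar> \<le> (\<Sum>i\<in>{N..<N + j}. r i)" using unbounded by blast
    from reach[OF this, of 0] show ?thesis by simp
  qed
  have "(\<lambda>N. exp (- real N) * M 0) \<longlonglongrightarrow> 0"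
    by (intro tendsto_mult_left_zero filterlim_compose[OF exp_at_bot]
        filterlim_compose[OF filterlim_uminus_at_bot_at_top] filterlim_real_sequentially)
  then have "\<bar>F 0 x\<bar> \<le> 0" by (rule LIMSEQ_le_const) (use bound in auto)
  then show ?thesis by simp
qed

section \<open>The cosine transform of the square root\<close>

text \<open>
  The square root with an independent fair random sign. On symmetric laws the characteristic function
  is real, and squaring recovers a nonnegative original variable.
\<close>
definition symmetrised_sqrt :: "real measure \<Rightarrow> real measure" where
  "symmetrised_sqrt D =
     distr (D \<Otimes>\<^sub>M measure_pmf (pmf_of_set {-1, 1})) borel (\<lambda>(x, e). e * sqrt x)"

lemma symmetrised_sqrt_measurable:
  assumes "real_distribution D"
  shows "(\<lambda>(x, e). e * sqrt x) \<in> borel_measurable (D \<Otimes>\<^sub>M measure_pmf (pmf_of_set {-1, 1}))"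
proof -
  interpret real_distribution D by fact
  have "(\<lambda>p. fst p :: real) \<in> borel_measurable (D \<Otimes>\<^sub>M measure_pmf (pmf_of_set {-1, 1::real}))"
    by (rule measurable_compose[OF measurable_fst]) simp
  moreover have "(\<lambda>p. snd p :: real) \<in> borel_measurable (D \<Otimes>\<^sub>M measure_pmf (pmf_of_set {-1, 1::real}))"
    by (rule measurable_compose[OF measurable_snd]) simp
  ultimately show ?thesis unfolding case_prod_beta by measurable
qed

lemma real_distribution_symmetrised_sqrt:
  assumes "real_distribution D"
  shows "real_distribution (symmetrised_sqrt D)"
proof -
  interpret real_distribution D by fact
  interpret pair_prob_space D "measure_pmf (pmf_of_set {-1, 1::real})" ..
  show ?thesis unfolding symmetrised_sqrt_def
    by (rule real_distribution_distr[OF symmetrised_sqrt_measurable[OF assms]])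
qed

lemma char_symmetrised_sqrt:
  assumes "real_distribution D"
  shows "char (symmetrised_sqrt D) t = complex_of_real (LINT x|D. cos (t * sqrt x))"
proof -
  let ?P = "measure_pmf (pmf_of_set {-1, 1::real})"
  interpret real_distribution D by fact
  interpret pair_prob_space D ?P ..
  note symmetrised_sqrt_measurable[OF assms, measurable]
  have int: "integrable (D \<Otimes>\<^sub>M ?P) (\<lambda>(x, e). iexp (t * (e * sqrt x)))"
  proof (rule integrable_const_bound[where B = 1])
    show "AE p in D \<Otimes>\<^sub>M ?P. norm (case p of (x, e) \<Rightarrow> iexp (t * (e * sqrt x))) \<le> 1"
      by (auto simp: case_prod_beta)
    have "(\<lambda>p. iexp (t * (case p of (x, e) \<Rightarrow> e * sqrt x))) \<in> borel_measurable (D \<Otimes>\<^sub>M ?P)"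
      by measurable
    then show "(\<lambda>(x, e). iexp (t * (e * sqrt x))) \<in> borel_measurable (D \<Otimes>\<^sub>M ?P)"
      by (simp add: case_prod_beta)
  qed
  have "char (symmetrised_sqrt D) t = (CLINT p|D \<Otimes>\<^sub>M ?P. iexp (t * (case p of (x, e) \<Rightarrow> e * sqrt x)))"
    unfolding char_def symmetrised_sqrt_def by (subst integral_distr) auto
  also have "\<dots> = (CLINT p|D \<Otimes>\<^sub>M ?P. (case p of (x, e) \<Rightarrow> iexp (t * (e * sqrt x))))"
    by (simp add: case_prod_beta)
  also have "\<dots> = (CLINT x|D. CLINT e|?P. iexp (t * (e * sqrt x)))"
    using integral_fst'[OF int] by simp
  also have "\<dots> = (CLINT x|D. complex_of_real (cos (t * sqrt x)))"
  proof (rule Bochner_Integration.integral_cong[OF refl])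
    fix x
    have "(CLINT e|?P. iexp (t * (e * sqrt x)))
        = (\<Sum>e\<in>{-1, 1}. pmf (pmf_of_set {-1, 1}) e *\<^sub>R iexp (t * (e * sqrt x)))"
      by (rule integral_measure_pmf) auto
    also have "\<dots> = complex_of_real (cos (t * sqrt x))"
      by (auto simp: complex_eq_iff Re_exp Im_exp)
    finally show "(CLINT e|?P. iexp (t * (e * sqrt x))) = complex_of_real (cos (t * sqrt x))" .
  qed
  finally show ?thesis by simp
qed

lemma distr_symmetrised_sqrt:
  assumes "real_distribution D" "AE x in D. 0 \<le> x"
  shows "distr (symmetrised_sqrt D) borel (\<lambda>z. z\<^sup>2) = D"
proof -
  let ?P = "measure_pmf (pmf_of_set {-1, 1::real})"
  interpret real_distribution D by fact
  interpret pair_prob_space D ?P ..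
  note symmetrised_sqrt_measurable[OF assms(1), measurable]
  have meas_fst: "fst \<in> borel_measurable (D \<Otimes>\<^sub>M ?P)"
    by (rule measurable_compose[OF measurable_fst]) simp
  have "AE p in D \<Otimes>\<^sub>M ?P. 0 \<le> fst p"
    using assms(2) meas_fst by (intro AE_pair_measure) auto
  moreover have "AE p in D \<Otimes>\<^sub>M ?P. snd p \<in> {-1, 1}"
  proof (rule AE_pair_measure)
    have "snd \<in> borel_measurable (D \<Otimes>\<^sub>M ?P)"
      by (rule measurable_compose[OF measurable_snd]) simp
    then show "{p \<in> space (D \<Otimes>\<^sub>M ?P). snd p \<in> {-1, 1}} \<in> sets (D \<Otimes>\<^sub>M ?P)" by measurable
  qed (auto simp: AE_measure_pmf_iff)
  ultimately have eq: "AE p in D \<Otimes>\<^sub>M ?P. (case p of (x, e) \<Rightarrow> e * sqrt x)\<^sup>2 = fst p"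
    by eventually_elim (auto simp: power_mult_distrib)
  have "distr (symmetrised_sqrt D) borel (\<lambda>z. z\<^sup>2)
      = distr (D \<Otimes>\<^sub>M ?P) borel (\<lambda>p. (case p of (x, e) \<Rightarrow> e * sqrt x)\<^sup>2)"
    unfolding symmetrised_sqrt_def by (subst distr_distr) (auto simp: comp_def)
  also have "\<dots> = distr (D \<Otimes>\<^sub>M ?P) borel fst"
    using eq meas_fst by (intro distr_cong_AE) auto
  also have "\<dots> = distr (D \<Otimes>\<^sub>M ?P) D fst" by (intro distr_cong) auto
  also have "\<dots> = D"
    by (rule prob_space.distr_pair_fst[OF prob_space_measure_pmf])
  finally show ?thesis .
qed

text \<open>
  The transform is the characteristic function of the symmetrised square root, so Levy's uniqueness
  theorem applies; squaring undoes the symmetrisation.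
\<close>
lemma cosine_transform_unique:
  assumes "real_distribution D" "AE x in D. 0 \<le> x"
    and "real_distribution D'" "AE x in D'. 0 \<le> x"
    and "\<And>t. (LINT x|D. cos (t * sqrt x)) = (LINT x|D'. cos (t * sqrt x))"
  shows "D = D'"
proof -
  have "symmetrised_sqrt D = symmetrised_sqrt D'"
    using assms by (intro Levy_uniqueness real_distribution_symmetrised_sqrt)
      (auto simp: char_symmetrised_sqrt)
  then show ?thesis using distr_symmetrised_sqrt assms by metis
qed

text \<open>
  The half-integer moments, which bound the derivatives of the cosine transform.
\<close>
definition sqrt_moment :: "real measure \<Rightarrow> nat \<Rightarrow> real" where
  "sqrt_moment D n = (LINT x|D. sqrt x ^ n)"

text \<open>
  What the \<open>n\<close>-th derivative of the cosine transform is after formal differentiation under the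
  integral: each differentiation shifts the phase by \<open>pi / 2\<close>. With this as the definition, Taylor's
  inequality follows by integrating a pointwise one, and no differentiation of integrals occurs.
\<close>
definition cosine_deriv :: "real measure \<Rightarrow> nat \<Rightarrow> real \<Rightarrow> real" where
  "cosine_deriv D n t = (LINT x|D. sqrt x ^ n * cos (t * sqrt x + real n * pi / 2))"

text \<open>
  For nonnegative \<open>x\<close>, \<open>sqrt x\<close> is at most \<open>1\<close> or at most \<open>x\<close>.
\<close>
lemma integrable_sqrt_power:
  assumes "nonneg_distribution_with_moments D"
  shows "integrable D (\<lambda>x. sqrt x ^ n)"
proof -
  interpret real_distribution D using assms by (simp add: nonneg_distribution_with_moments_def)
  have nonneg: "AE x in D. 0 \<le> x" and "integrable D (\<lambda>x. x ^ n)"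
    using assms by (cases "n = 0"; simp add: nonneg_distribution_with_moments_def)+
  then have int: "integrable D (\<lambda>x. 1 + x ^ n)" by simp
  show ?thesis
  proof (rule Bochner_Integration.integrable_bound[OF int])
    show "AE x in D. norm (sqrt x ^ n) \<le> norm (1 + x ^ n)" using nonneg
    proof eventually_elim
      case (elim x)
      show ?case
      proof (cases "x \<le> 1")
        case True
        then have "sqrt x ^ n \<le> 1" using elim by (intro power_le_one) auto
        then show ?thesis using elim by (simp add: add_increasing2)
      next
        case False
        then have "sqrt x ^ n \<le> x ^ n" using elim
          by (intro power_mono real_le_lsqrt) (auto simp: power2_eq_square)
        then show ?thesis using elim by simp
      qed
    qed
  qed simp
qed

lemma integrable_cosine_deriv:
  assumes "nonneg_distribution_with_moments D"
  shows "integrable D (\<lambda>x. sqrt x ^ n * cos (t * sqrt x + c))"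
proof -
  interpret real_distribution D using assms by (simp add: nonneg_distribution_with_moments_def)
  show ?thesis
    by (rule Bochner_Integration.integrable_bound[OF integrable_sqrt_power[OF assms, of n]])
      (auto simp: abs_mult mult_left_le)
qed

lemma cos_taylor_bound:
  fixes s t h :: real
  assumes "0 \<le> s"
  shows "\<bar>s ^ n * cos ((t + h) * s + real n * pi / 2)
      - (\<Sum>k<m. s ^ (n + k) * cos (t * s + real (n + k) * pi / 2) * h ^ k / fact k)\<bar>
      \<le> s ^ (n + m) * \<bar>h\<bar> ^ m / fact m"
proof -
  define d where "d k y = s ^ (n + k) * cos ((t + y) * s + real (n + k) * pi / 2)" for k y
  have "(d k has_real_derivative d (Suc k) y) (at y)" for k y
  proof -
    have "cos ((t + y) * s + real (n + Suc k) * pi / 2) = - sin ((t + y) * s + real (n + k) * pi / 2)"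
      using cos_add[of "(t + y) * s + real (n + k) * pi / 2" "pi / 2"]
      by (simp add: field_simps)
    then show ?thesis unfolding d_def
      by (auto intro!: derivative_eq_intros simp: algebra_simps)
  qed
  then obtain y where "d 0 h = (\<Sum>k<m. d k 0 / fact k * h ^ k) + d m y / fact m * h ^ m"
    using Maclaurin_all_le[of d "d 0" h m] by auto
  then have "d 0 h - (\<Sum>k<m. d k 0 * h ^ k / fact k) = d m y * (h ^ m / fact m)" by simp
  moreover have "\<bar>d m y * (h ^ m / fact m)\<bar> \<le> s ^ (n + m) * (\<bar>h\<bar> ^ m / fact m)"
    unfolding abs_mult using assms
    by (intro mult_mono) (auto simp: d_def abs_mult mult_left_le power_abs)
  ultimately show ?thesis by (simp add: d_def)
qed

lemma cosine_deriv_taylor: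
  assumes "nonneg_distribution_with_moments D"
  shows "\<bar>cosine_deriv D n (t + h) - (\<Sum>k<m. cosine_deriv D (n + k) t * h ^ k / fact k)\<bar>
      \<le> sqrt_moment D (n + m) * \<bar>h\<bar> ^ m / fact m"
proof -
  interpret real_distribution D using assms by (simp add: nonneg_distribution_with_moments_def)
  note [simp] = integrable_cosine_deriv[OF assms] integrable_sqrt_power[OF assms]
  let ?R = "\<lambda>x. sqrt x ^ n * cos ((t + h) * sqrt x + real n * pi / 2)
      - (\<Sum>k<m. sqrt x ^ (n + k) * cos (t * sqrt x + real (n + k) * pi / 2) * (h ^ k / fact k))"
  have int: "integrable D ?R"
    by (intro Bochner_Integration.integrable_diff Bochner_Integration.integrable_sum
        integrable_mult_left) auto
  have eq: "cosine_deriv D n (t + h) - (\<Sum>k<m. cosine_deriv D (n + k) t * h ^ k / fact k) = (LINT x|D. ?R x)"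
  proof -
    have "(LINT x|D. ?R x) = cosine_deriv D n (t + h)
        - (LINT x|D. (\<Sum>k<m. sqrt x ^ (n + k) * cos (t * sqrt x + real (n + k) * pi / 2) * (h ^ k / fact k)))"
      unfolding cosine_deriv_def
      by (intro Bochner_Integration.integral_diff Bochner_Integration.integrable_sum
          integrable_mult_left) auto
    also have "(LINT x|D. (\<Sum>k<m. sqrt x ^ (n + k) * cos (t * sqrt x + real (n + k) * pi / 2) * (h ^ k / fact k)))
        = (\<Sum>k<m. cosine_deriv D (n + k) t * (h ^ k / fact k))"
      unfolding cosine_deriv_def
      by (subst Bochner_Integration.integral_sum)
        (auto intro!: integrable_mult_left sum.cong integral_mult_left_zero simp del: times_divide_eq_right)
    finally show ?thesis by (simp only: times_divide_eq_right)
  qed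
  have bound: "\<bar>LINT x|D. ?R x\<bar> \<le> (LINT x|D. sqrt x ^ (n + m) * (\<bar>h\<bar> ^ m / fact m))"
  proof (rule order.trans[OF integral_abs_bound], rule integral_mono_AE)
    show "integrable D (\<lambda>x. \<bar>?R x\<bar>)" using int by (rule integrable_abs)
    show "integrable D (\<lambda>x. sqrt x ^ (n + m) * (\<bar>h\<bar> ^ m / fact m))"
      by (intro integrable_mult_left) simp
    have "AE x in D. 0 \<le> x" using assms by (simp add: nonneg_distribution_with_moments_def)
    then show "AE x in D. \<bar>?R x\<bar> \<le> sqrt x ^ (n + m) * (\<bar>h\<bar> ^ m / fact m)"
    proof eventually_elim
      case (elim x)
      then show ?case
        using cos_taylor_bound[OF real_sqrt_ge_zero[OF elim], of n t h m]
        by (simp only: times_divide_eq_right)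
    qed
  qed
  have "(LINT x|D. sqrt x ^ (n + m) * (\<bar>h\<bar> ^ m / fact m)) = sqrt_moment D (n + m) * (\<bar>h\<bar> ^ m / fact m)"
    unfolding sqrt_moment_def by (rule integral_mult_left_zero)
  with bound show ?thesis by (simp only: eq times_divide_eq_right)
qed

text \<open>
  The integral of \<open>(sqrt x)^n (sqrt x - c)\<^sup>2\<close>. Log-convexity follows with the best \<open>c\<close>; in this form
  the inequality is linear in the measure and can be averaged over two distributions.
\<close>
lemma sqrt_moment_quadratic:
  assumes "nonneg_distribution_with_moments D"
  shows "0 \<le> sqrt_moment D (Suc (Suc n)) - 2 * c * sqrt_moment D (Suc n) + c\<^sup>2 * sqrt_moment D n"
proof -
  note [simp] = integrable_sqrt_power[OF assms]
  have nonneg: "AE x in D. 0 \<le> x"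
    using assms by (simp add: nonneg_distribution_with_moments_def)
  have "0 \<le> (LINT x|D. sqrt x ^ n * (sqrt x - c)\<^sup>2)"
    using nonneg by (intro integral_nonneg_AE) (auto elim!: eventually_mono)
  also have "\<dots> = (LINT x|D. sqrt x ^ Suc (Suc n) - 2 * c * sqrt x ^ Suc n + c\<^sup>2 * sqrt x ^ n)"
    by (intro Bochner_Integration.integral_cong) (auto simp: power2_eq_square algebra_simps)
  also have "\<dots> = sqrt_moment D (Suc (Suc n)) - 2 * c * sqrt_moment D (Suc n) + c\<^sup>2 * sqrt_moment D n"
    unfolding sqrt_moment_def
    by (simp only: Bochner_Integration.integral_add Bochner_Integration.integral_diff
        integrable_sqrt_power[OF assms] integrable_mult_right Bochner_Integration.integrable_diff
        integral_mult_right_zero)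
  finally show ?thesis .
qed

lemma sqrt_moment_even:
  assumes "nonneg_distribution_with_moments D"
  shows "sqrt_moment D (2 * n) = (LINT x|D. x ^ n)"
proof -
  interpret real_distribution D using assms by (simp add: nonneg_distribution_with_moments_def)
  have "AE x in D. 0 \<le> x" using assms by (simp add: nonneg_distribution_with_moments_def)
  then show ?thesis unfolding sqrt_moment_def
    by (intro integral_cong_AE) (auto elim!: eventually_mono simp: power_mult)
qed

lemma sqrt_moment_nonneg:
  assumes "nonneg_distribution_with_moments D"
  shows "0 \<le> sqrt_moment D n"
proof -
  have "AE x in D. 0 \<le> x" using assms by (simp add: nonneg_distribution_with_moments_def)
  then show ?thesis unfolding sqrt_moment_def
    by (intro integral_nonneg_AE) (auto elim!: eventually_mono)
qed

lemma sqrt_moment_pos: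
  assumes "nonneg_distribution_with_moments D" and "(LINT x|D. x ^ Suc k) \<noteq> 0"
  shows "0 < sqrt_moment D n"
proof (rule ccontr)
  interpret real_distribution D using assms by (simp add: nonneg_distribution_with_moments_def)
  assume "\<not> 0 < sqrt_moment D n"
  then have "(LINT x|D. sqrt x ^ n) = 0"
    using sqrt_moment_nonneg[OF assms(1), of n] by (simp add: sqrt_moment_def)
  moreover have nonneg: "AE x in D. 0 \<le> x"
    using assms by (simp add: nonneg_distribution_with_moments_def)
  ultimately have "AE x in D. sqrt x ^ n = 0"
    by (subst (asm) integral_nonneg_eq_0_iff_AE[OF integrable_sqrt_power[OF assms(1)]])
      (auto elim!: eventually_mono)
  then have "(LINT x|D. x ^ Suc k) = (LINT x|D. 0)"
    by (intro integral_cong_AE) (auto elim!: eventually_mono)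
  then show False using assms(2) by simp
qed

section \<open>Carleman's condition implies determinacy\<close>

text \<open>
  Carleman's theorem for the Stieltjes moment problem. The sequence \<open>M\<close> averages both distributions
  because their half-integer moments of odd order are not yet known to agree.
\<close>
theorem carleman_imp_M_det:
  assumes D: "nonneg_distribution_with_moments D"
    and carleman: "(\<Sum>n. ennreal ((LINT x|D. x ^ Suc n) powr (- 1 / (2 * real (Suc n))))) = \<infinity>"
  shows "M_det_nonneg D"
  unfolding M_det_nonneg_def
proof (intro conjI D allI impI)
  fix D'
  assume D': "nonneg_distribution_with_moments D'"
    and "\<forall>n\<ge>1. (LINT x|D'. x ^ n) = (LINT x|D. x ^ n)"
  then have eq: "(LINT x|D'. x ^ n) = (LINT x|D. x ^ n)" if "1 \<le> n" for n using that by blast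
  interpret D: real_distribution D using D by (simp add: nonneg_distribution_with_moments_def)
  interpret D': real_distribution D' using D' by (simp add: nonneg_distribution_with_moments_def)
  define F where "F n t = (cosine_deriv D n t - cosine_deriv D' n t) / 2" for n t
  define M where "M n = (sqrt_moment D n + sqrt_moment D' n) / 2" for n
  \<comment> \<open>Powers of zero are zero for \<open>powr\<close>, so for the point mass at \<open>0\<close> the sum would be \<open>0\<close>.\<close>
  have "\<exists>k. (LINT x|D. x ^ Suc k) \<noteq> 0"
  proof (rule ccontr)
    assume "\<not> ?thesis"
    then have "(\<Sum>n. ennreal ((LINT x|D. x ^ Suc n) powr (- 1 / (2 * real (Suc n))))) = 0"
      by simp
    then show False using carleman by simp
  qed
  then obtain k where "(LINT x|D. x ^ Suc k) \<noteq> 0" ..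
  then have pos: "0 < M n" for n
    unfolding M_def using sqrt_moment_pos[OF D, of k n] sqrt_moment_nonneg[OF D', of n] by simp
  have mass: "measure D UNIV = 1" "measure D' UNIV = 1"
    using D.prob_space D'.prob_space by simp_all
  then have sqrt_moment_0: "sqrt_moment D 0 = 1" "sqrt_moment D' 0 = 1"
    by (simp_all add: sqrt_moment_def)
  have M_even: "M (2 * n) = (LINT x|D. x ^ n)" for n
    using eq[of n] mass sqrt_moment_0
    by (cases "n = 0") (simp_all add: M_def sqrt_moment_even[OF D] sqrt_moment_even[OF D'])
  have logconv: "(M (Suc n))\<^sup>2 \<le> M n * M (Suc (Suc n))" for n
  proof -
    define c where "c = M (Suc n) / M n"
    have "0 \<le> M (Suc (Suc n)) - 2 * c * M (Suc n) + c\<^sup>2 * M n"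
      using sqrt_moment_quadratic[OF D, of n c] sqrt_moment_quadratic[OF D', of n c]
      unfolding M_def by argo
    also have "\<dots> = M (Suc (Suc n)) - (M (Suc n))\<^sup>2 / M n"
      using pos[of n] by (simp add: c_def power2_eq_square)
    finally show ?thesis using pos[of n] by (simp add: field_simps)
  qed
  have taylor: "\<bar>F n (x + h) - (\<Sum>k<m. F (n + k) x * h ^ k / fact k)\<bar> \<le> M (n + m) * \<bar>h\<bar> ^ m / fact m"
    for n m x h
  proof -
    have "(\<Sum>k<m. F (n + k) x * h ^ k / fact k) = ((\<Sum>k<m. cosine_deriv D (n + k) x * h ^ k / fact k)
        - (\<Sum>k<m. cosine_deriv D' (n + k) x * h ^ k / fact k)) / 2"
      unfolding F_def sum_subtractf [symmetric] sum_divide_distrib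
      by (intro sum.cong refl) (simp add: field_simps)
    then have "F n (x + h) - (\<Sum>k<m. F (n + k) x * h ^ k / fact k)
      = ((cosine_deriv D n (x + h) - (\<Sum>k<m. cosine_deriv D (n + k) x * h ^ k / fact k))
        - (cosine_deriv D' n (x + h) - (\<Sum>k<m. cosine_deriv D' (n + k) x * h ^ k / fact k))) / 2"
      by (simp add: F_def field_simps)
    moreover have "M (n + m) * \<bar>h\<bar> ^ m / fact m = (sqrt_moment D (n + m) * \<bar>h\<bar> ^ m / fact m
        + sqrt_moment D' (n + m) * \<bar>h\<bar> ^ m / fact m) / 2"
      by (simp add: M_def add_divide_distrib distrib_right)
    moreover have "\<bar>(a - b) / 2\<bar> \<le> (A + B) / 2" if "\<bar>a\<bar> \<le> A" "\<bar>b\<bar> \<le> B" for a b A B :: real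
      using that abs_triangle_ineq4[of a b] by simp
    ultimately show ?thesis
      using cosine_deriv_taylor[OF D] cosine_deriv_taylor[OF D'] by presburger
  qed
  have flat: "F n 0 = 0" for n
  proof (cases "even n")
    case True
    then obtain j where "n = 2 * j" by blast
    then have "sqrt_moment D n = sqrt_moment D' n"
      using eq[of j] sqrt_moment_0
      by (cases "j = 0") (simp_all add: sqrt_moment_even[OF D] sqrt_moment_even[OF D'])
    then show ?thesis by (simp add: F_def cosine_deriv_def sqrt_moment_def)
  next
    case False
    then have "cos (real n * pi / 2) = 0"
      unfolding cos_zero_iff by (intro disjI1 exI[of _ n]) simp
    then show ?thesis by (simp add: F_def cosine_deriv_def)
  qed
  have "\<not> summable (\<lambda>n. M n / M (Suc n))"
  proof
    assume "summable (\<lambda>n. M n / M (Suc n))"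
    then have "summable (\<lambda>n. (\<Prod>k\<le>n. M k / M (Suc k)) powr (1 / real (Suc n)))"
      using pos by (intro carleman_inequality) (auto intro!: divide_nonneg_nonneg less_imp_le)
    moreover have "(\<Prod>k\<le>n. M k / M (Suc k)) = 1 / M (Suc n)" for n
    proof (induction n)
      case 0
      then show ?case using M_even[of 0] mass by simp
    next
      case (Suc n)
      then show ?case using pos[of "Suc n"] by simp
    qed
    ultimately have "summable (\<lambda>n. (1 / M (Suc n)) powr (1 / real (Suc n)))" by simp
    \<comment> \<open>Only the terms of even order are known from the moments; they are already enough.\<close>
    then have "summable ((\<lambda>n. (1 / M (Suc n)) powr (1 / real (Suc n))) \<circ> (\<lambda>j. 2 * j + 1))"
      by (rule summable_reindex) (auto simp: inj_on_def)
    also have "(\<lambda>n. (1 / M (Suc n)) powr (1 / real (Suc n))) \<circ> (\<lambda>j. 2 * j + 1)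
        = (\<lambda>n. (LINT x|D. x ^ Suc n) powr (- 1 / (2 * real (Suc n))))"
    proof
      fix j
      have "Suc (2 * j + 1) = 2 * Suc j" by simp
      then show "((\<lambda>n. (1 / M (Suc n)) powr (1 / real (Suc n))) \<circ> (\<lambda>j. 2 * j + 1)) j
          = (LINT x|D. x ^ Suc j) powr (- 1 / (2 * real (Suc j)))"
        using pos[of "2 * Suc j"] unfolding comp_def
        by (simp only: M_even powr_minus_divide minus_divide_left [symmetric]) 
          (simp add: powr_divide)
    qed
    finally show False using carleman ennreal_suminf_neq_top by fastforce
  qed
  then have "F 0 t = 0" for t
    by (rule bang_quasianalytic[where F = F and M = M, OF pos logconv taylor _ flat])
  then have "(LINT x|D'. cos (t * sqrt x)) = (LINT x|D. cos (t * sqrt x))" for t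
    by (simp add: F_def cosine_deriv_def)
  then show "D' = D"
    using D D' by (intro cosine_transform_unique) (auto simp: nonneg_distribution_with_moments_def)
qed

section \<open>The inverse of the shift\<close>

lemma admissible_shiftD:
  assumes "admissible_shift x0 \<phi>"
  shows "x0 \<le> x \<Longrightarrow> 0 \<le> \<phi> x" "continuous_on {x0..} \<phi>"
    "strict_mono_on {x0..} (\<lambda>x. x + \<phi> x)" "inj_on (\<lambda>x. x + \<phi> x) {x0..}"
proof -
  have "(\<forall>x\<ge>x0. 0 \<le> \<phi> x) \<and> \<phi> differentiable_on {x0..} \<and> strict_mono_on {x0..} (\<lambda>x. x + \<phi> x)"
    using assms unfolding admissible_shift_def by (elim conjE) (intro conjI)
  then show "x0 \<le> x \<Longrightarrow> 0 \<le> \<phi> x" "continuous_on {x0..} \<phi>"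
    "strict_mono_on {x0..} (\<lambda>x. x + \<phi> x)" "inj_on (\<lambda>x. x + \<phi> x) {x0..}"
    by (simp_all add: differentiable_imp_continuous_on strict_mono_on_imp_inj_on)
qed

text \<open>
  Existence of the preimage is the intermediate value theorem on \<open>[x0, y]\<close>, where \<open>y + \<phi> y \<ge> y\<close>.
\<close>
lemma shift_inverse_right:
  assumes "admissible_shift x0 \<phi>" and "x0 + \<phi> x0 \<le> y"
  shows "x0 \<le> shift_inverse x0 \<phi> y" "shift_inverse x0 \<phi> y + \<phi> (shift_inverse x0 \<phi> y) = y"
proof -
  note nonneg = admissible_shiftD(1)[OF assms(1)] and inj = admissible_shiftD(4)[OF assms(1)]
  have "continuous_on {x0..y} (\<lambda>x. x + \<phi> x)"
    using admissible_shiftD(2)[OF assms(1)]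
    by (intro continuous_intros) (auto elim: continuous_on_subset)
  moreover have "x0 \<le> y" using assms(2) nonneg[of x0] by simp
  ultimately obtain x where x: "x0 \<le> x" "x + \<phi> x = y"
    using IVT'[of "\<lambda>x. x + \<phi> x" x0 y y] assms(2) nonneg[of y] by auto
  then have "shift_inverse x0 \<phi> y = x"
    unfolding shift_inverse_def using the_inv_into_f_f[OF inj, of x] by auto
  with x show "x0 \<le> shift_inverse x0 \<phi> y" "shift_inverse x0 \<phi> y + \<phi> (shift_inverse x0 \<phi> y) = y"
    by auto
qed

lemma shift_inverse_left:
  assumes "admissible_shift x0 \<phi>" and "x0 \<le> x"
  shows "shift_inverse x0 \<phi> (x + \<phi> x) = x"
  using the_inv_into_f_f[OF admissible_shiftD(4)[OF assms(1)], of x] assms(2)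
  by (simp add: shift_inverse_def)

lemma shift_le_iff:
  assumes "admissible_shift x0 \<phi>" and "x0 \<le> x" "x0 \<le> x'"
  shows "x + \<phi> x \<le> x' + \<phi> x' \<longleftrightarrow> x \<le> x'"
  using strict_mono_on_less_eq[OF admissible_shiftD(3)[OF assms(1)], of x x'] assms(2,3) by simp

lemma shift_inverse_le_iff:
  assumes "admissible_shift x0 \<phi>" and "x0 + \<phi> x0 \<le> y" "x0 + \<phi> x0 \<le> y'"
  shows "shift_inverse x0 \<phi> y \<le> shift_inverse x0 \<phi> y' \<longleftrightarrow> y \<le> y'"
  using shift_le_iff[OF assms(1), of "shift_inverse x0 \<phi> y" "shift_inverse x0 \<phi> y'"]
    shift_inverse_right[OF assms(1,2)] shift_inverse_right[OF assms(1,3)] by simp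

lemma shift_inverse_image:
  assumes "admissible_shift x0 \<phi>" and "x0 + \<phi> x0 \<le> b"
  shows "shift_inverse x0 \<phi> ` {b..} = {shift_inverse x0 \<phi> b..}"
proof (intro equalityI subsetI)
  fix x assume "x \<in> shift_inverse x0 \<phi> ` {b..}"
  then show "x \<in> {shift_inverse x0 \<phi> b..}"
    using shift_inverse_le_iff[OF assms(1)] assms(2) by auto
next
  fix x assume x: "x \<in> {shift_inverse x0 \<phi> b..}"
  then have "x0 \<le> x" using shift_inverse_right(1)[OF assms] by simp
  then have "b \<le> x + \<phi> x"
    using x shift_le_iff[OF assms(1), of "shift_inverse x0 \<phi> b" x] shift_inverse_right[OF assms] by simp
  then show "x \<in> shift_inverse x0 \<phi> ` {b..}"
    using shift_inverse_left[OF assms(1) \<open>x0 \<le> x\<close>] by (intro image_eqI[where x = "x + \<phi> x"]) auto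
qed

text \<open>
  The hypotheses on the shift and the decay of the density, restated for the inverse \<open>\<xi>\<close> beyond one common
  threshold \<open>B\<close>. There \<open>\<xi>' = 1 - \<psi>'\<close>, where \<open>\<psi>\<close> is the dual shift.
\<close>
lemma shift_inverse_eventually:
  assumes "0 < x0" and adm: "admissible_shift x0 \<phi>"
    and g_pos: "\<And>x. x0 \<le> x \<Longrightarrow> 0 < g x"
    and limsup: "Limsup at_top (\<lambda>x. ereal (g ((x + \<phi> x)\<^sup>2) / g (x\<^sup>2))) < 1"
  defines "\<xi> \<equiv> shift_inverse x0 \<phi>"
  obtains B C q \<xi>' where
    "exp 1 \<le> B" "x0 + \<phi> x0 \<le> B" "0 < C" "0 < q" "q < 1"
    "\<And>y. B \<le> y \<Longrightarrow> (\<xi> has_real_derivative \<xi>' y) (at y)"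
    "\<And>y. B \<le> y \<Longrightarrow> \<xi>' y \<in> {0..1}" "\<And>y. B \<le> y \<Longrightarrow> y * (1 - \<xi>' y) \<le> C"
    "\<And>y. B \<le> y \<Longrightarrow> 0 < \<xi> y" "\<And>y. B \<le> y \<Longrightarrow> \<xi> y \<le> y" "\<And>y. B \<le> y \<Longrightarrow> y - \<xi> y \<le> C * ln y"
    "\<And>y. B \<le> y \<Longrightarrow> x0 \<le> (\<xi> y)\<^sup>2" "\<And>y. B \<le> y \<Longrightarrow> g (y\<^sup>2) \<le> q * g ((\<xi> y)\<^sup>2)"
proof -
  define y0 where "y0 = x0 + \<phi> x0"
  define \<psi> where "\<psi> = dual_shift x0 \<phi>"
  have \<psi>: "\<psi> y = y - \<xi> y" for y by (simp add: \<psi>_def dual_shift_def \<xi>_def)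
  obtain C ystar \<psi>' where "0 < C" "y0 \<le> ystar" and
    dual: "\<And>y. ystar \<le> y \<Longrightarrow> (\<psi> has_real_derivative \<psi>' y) (at y within {y0..}) \<and>
      \<psi>' y \<in> {0..1} \<and> \<psi> y \<le> C * ln y \<and> y * \<psi>' y \<le> C"
    using adm unfolding admissible_shift_def Let_def y0_def \<psi>_def by blast
  obtain p where "Limsup at_top (\<lambda>x. ereal (g ((x + \<phi> x)\<^sup>2) / g (x\<^sup>2))) < ereal p" "ereal p < 1"
    using ereal_dense2[OF limsup] by blast
  then have "p < 1" and "\<forall>\<^sub>F x in at_top. g ((x + \<phi> x)\<^sup>2) / g (x\<^sup>2) < p"
    using Limsup_lessD[of at_top "\<lambda>x. ereal (g ((x + \<phi> x)\<^sup>2) / g (x\<^sup>2))" "ereal p"]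
    by (simp_all add: one_ereal_def)
  then obtain X where X: "\<And>x. X \<le> x \<Longrightarrow> g ((x + \<phi> x)\<^sup>2) / g (x\<^sup>2) < p"
    unfolding eventually_at_top_linorder by blast
  \<comment> \<open>The maximum only ensures \<open>0 < q\<close>.\<close>
  define q where "q = max p (1 / 2)"
  have q: "0 < q" "q < 1" using \<open>p < 1\<close> by (auto simp: q_def)
  \<comment> \<open>Making \<open>X1\<close> at least \<open>1\<close> and \<open>x0\<close> ensures that \<open>(\<xi> y)\<^sup>2 \<ge> \<xi> y \<ge> x0\<close>, where \<open>g\<close> is a density.\<close>
  define X1 where "X1 = max (max X x0) 1"
  define B where "B = max (max (exp 1) (y0 + 1)) (max ystar (X1 + \<phi> X1))"
  have "x0 \<le> X1" by (simp add: X1_def)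
  have in_dom: "x0 + \<phi> x0 \<le> y" if "B \<le> y" for y
    using that by (simp add: B_def y0_def)
  note right = shift_inverse_right[OF adm in_dom, folded \<xi>_def]
  have X1_le: "X1 \<le> \<xi> y" if "B \<le> y" for y
    using shift_le_iff[OF adm \<open>x0 \<le> X1\<close> right(1)[OF that]] right(2)[OF that] that
    by (simp add: B_def)
  have \<xi>_sq: "x0 \<le> (\<xi> y)\<^sup>2" if "B \<le> y" for y
  proof -
    have "x0 \<le> \<xi> y * 1" using right(1)[OF that] by simp
    also have "\<dots> \<le> \<xi> y * \<xi> y"
      using X1_le[OF that] right(1)[OF that] \<open>0 < x0\<close> by (intro mult_left_mono) (auto simp: X1_def)
    finally show ?thesis by (simp add: power2_eq_square)
  qed
  show ?thesis
  proof (rule that[of B C q "\<lambda>y. 1 - \<psi>' y"])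
    fix y assume y: "B \<le> y"
    then have dual_y: "(\<psi> has_real_derivative \<psi>' y) (at y within {y0..})" "\<psi>' y \<in> {0..1}"
      "\<psi> y \<le> C * ln y" "y * \<psi>' y \<le> C"
      using dual[of y] by (auto simp: B_def)
    have "y0 < y" using y by (simp add: B_def)
    then have "at y within {y0..} = at y" by (intro at_within_interior) (simp add: interior_Ici)
    with dual_y have "(\<psi> has_real_derivative \<psi>' y) (at y)" by simp
    from DERIV_diff[OF DERIV_ident this]
    show "(\<xi> has_real_derivative 1 - \<psi>' y) (at y)" by (simp add: \<psi>)
    show "1 - \<psi>' y \<in> {0..1}" "y * (1 - (1 - \<psi>' y)) \<le> C" "y - \<xi> y \<le> C * ln y"
      using dual_y by (auto simp: \<psi>)
    show "0 < \<xi> y" using right(1)[OF y] \<open>0 < x0\<close> by simp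
    show "\<xi> y \<le> y" using right[OF y] admissible_shiftD(1)[OF adm, of "\<xi> y"] by simp
    show "x0 \<le> (\<xi> y)\<^sup>2" by (rule \<xi>_sq[OF y])
    have "0 < g ((\<xi> y)\<^sup>2)" by (rule g_pos[OF \<xi>_sq[OF y]])
    moreover have "X \<le> \<xi> y" using X1_le[OF y] by (simp add: X1_def)
    ultimately have "g (y\<^sup>2) \<le> p * g ((\<xi> y)\<^sup>2)"
      using X[of "\<xi> y"] right(2)[OF y] by (simp add: divide_less_eq)
    also have "\<dots> \<le> q * g ((\<xi> y)\<^sup>2)"
      using \<open>0 < g ((\<xi> y)\<^sup>2)\<close> by (intro mult_right_mono) (auto simp: q_def)
    finally show "g (y\<^sup>2) \<le> q * g ((\<xi> y)\<^sup>2)" .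
  qed (use q \<open>0 < C\<close> in \<open>auto simp: B_def y0_def\<close>)
qed

section \<open>Comparison of two tail integrals\<close>

text \<open>
  Transfers tail moments of \<open>D\<close> to gauge integrals, for which a change of variables with a merely
  differentiable substitution is available.
\<close>
lemma density_tail_moment:
  assumes "real_distribution D" "has_density_from D x0 g" "\<And>x. x0 \<le> x \<Longrightarrow> 0 \<le> g x"
    and int: "integrable D (\<lambda>x. x ^ n)" and "x0 \<le> a"
  shows "(\<lambda>t. t ^ n * g t) absolutely_integrable_on {a..}"
    and "integral {a..} (\<lambda>t. t ^ n * g t) = (LINT x:{a..}|D. x ^ n)"
proof -
  interpret real_distribution D by fact
  define f :: "real \<Rightarrow> real" where "f x = indicator {a..} x * x ^ n" for x
  define G where "G x = indicator {a..} x *\<^sub>R (x ^ n * g x)" for x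
  have f_meas: "f \<in> borel_measurable borel" unfolding f_def by measurable
  have g_meas: "g \<in> borel_measurable (restrict_space lborel {x0..})"
    using assms(2) by (simp add: has_density_from_def cong: measurable_cong_sets restrict_space_sets_cong)
  have restr: "restrict_space D {x0..} = density (restrict_space lborel {x0..}) (\<lambda>x. ennreal (g x))"
    using assms(2) by (simp add: has_density_from_def)
  have f_meas': "f \<in> borel_measurable (restrict_space lborel {x0..})"
    using f_meas by (intro measurable_restrict_space1) simp
  have nn: "AE x in restrict_space lborel {x0..}. 0 \<le> g x"
    using assms(3) by (intro AE_I2) (simp add: space_restrict_space)
  have f_ind: "(\<lambda>x. indicator {x0..} x *\<^sub>R f x) = f"
    using \<open>x0 \<le> a\<close> by (auto simp: f_def indicator_def)
  have G_ind: "(\<lambda>x. indicator {x0..} x *\<^sub>R (g x *\<^sub>R f x)) = G"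
    using \<open>x0 \<le> a\<close> by (auto simp: f_def G_def indicator_def)
  have intD: "integrable D f"
    unfolding f_def using integrable_real_mult_indicator[OF _ int, of "{a..}"] by (simp add: mult.commute)
  then have "integrable (restrict_space D {x0..}) f"
    by (subst integrable_restrict_space) (simp_all add: f_ind [unfolded real_scaleR_def])
  then have "integrable (restrict_space lborel {x0..}) (\<lambda>x. g x *\<^sub>R f x)"
    unfolding restr using integrable_density[OF f_meas' g_meas nn] by simp
  then have G: "integrable lborel G"
    by (subst (asm) integrable_restrict_space) (simp_all add: G_ind [unfolded real_scaleR_def])
  then have G': "integrable lebesgue G"
    by (subst integrable_completion) auto
  then show ai: "(\<lambda>t. t ^ n * g t) absolutely_integrable_on {a..}"
    by (simp only: set_integrable_def G_def [abs_def])
  have "integral {a..} (\<lambda>t. t ^ n * g t) = integral\<^sup>L lebesgue G"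
    using set_lebesgue_integral_eq_integral(2)[OF ai]
    by (simp only: set_lebesgue_integral_def G_def [abs_def])
  also have "\<dots> = integral\<^sup>L lborel G"
    using G by (intro integral_completion) auto
  also have "\<dots> = integral\<^sup>L (restrict_space lborel {x0..}) (\<lambda>x. g x *\<^sub>R f x)"
    by (subst integral_restrict_space) (simp_all add: G_ind [unfolded real_scaleR_def])
  also have "\<dots> = integral\<^sup>L (restrict_space D {x0..}) f"
    unfolding restr using integral_density[OF f_meas' g_meas nn] by simp
  also have "\<dots> = integral\<^sup>L D f"
    by (subst integral_restrict_space) (simp_all add: f_ind [unfolded real_scaleR_def])
  finally show "integral {a..} (\<lambda>t. t ^ n * g t) = (LINT x:{a..}|D. x ^ n)"
    by (simp only: set_lebesgue_integral_def f_def [abs_def] real_scaleR_def)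
qed

text \<open>
  Substitution \<open>u = \<sigma> t = (\<xi> (sqrt t))\<^sup>2\<close>, which maps \<open>[b\<^sup>2, \<infinity>)\<close> onto \<open>[(\<xi> b)\<^sup>2, \<infinity>)\<close>. With \<open>y = sqrt t\<close>
  the transformed integrand is \<open>\<xi>' y (\<xi> y / y)^(2 n + 1) t^n g ((\<xi> y)\<^sup>2)\<close>, and the last factor is at least
  \<open>g t / q\<close>.
\<close>
lemma tail_integral_comparison:
  fixes \<xi> \<xi>' g :: "real \<Rightarrow> real"
  assumes "0 < b" "0 < q"
    and deriv: "\<And>y. b \<le> y \<Longrightarrow> (\<xi> has_real_derivative \<xi>' y) (at y)"
    and \<xi>'_nonneg: "\<And>y. b \<le> y \<Longrightarrow> 0 \<le> \<xi>' y"
    and \<xi>_pos: "\<And>y. b \<le> y \<Longrightarrow> 0 < \<xi> y" and "\<xi> b \<le> b"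
    and inj: "inj_on \<xi> {b..}" and image: "\<xi> ` {b..} = {\<xi> b..}"
    and lower: "\<And>y. b \<le> y \<Longrightarrow> c \<le> \<xi>' y * (\<xi> y / y) ^ (2 * n + 1)"
    and g_nonneg: "\<And>y. b \<le> y \<Longrightarrow> 0 \<le> g (y\<^sup>2)"
    and decay: "\<And>y. b \<le> y \<Longrightarrow> g (y\<^sup>2) \<le> q * g ((\<xi> y)\<^sup>2)"
    and int: "(\<lambda>t. t ^ n * g t) absolutely_integrable_on {(\<xi> b)\<^sup>2..}"
  shows "c * integral {b\<^sup>2..} (\<lambda>t. t ^ n * g t) \<le> q * integral {(\<xi> b)\<^sup>2..} (\<lambda>t. t ^ n * g t)"
proof -
  let ?G = "\<lambda>t. t ^ n * g t"
  define \<sigma> where "\<sigma> t = (\<xi> (sqrt t))\<^sup>2" for t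
  define \<sigma>' where "\<sigma>' t = \<xi>' (sqrt t) * (\<xi> (sqrt t) / sqrt t)" for t
  have sqrt_ge: "b \<le> sqrt t" if "b\<^sup>2 \<le> t" for t
    using that \<open>0 < b\<close> by (simp add: real_le_rsqrt)
  have der: "(\<sigma> has_real_derivative \<sigma>' t) (at t within {b\<^sup>2..})" if "t \<in> {b\<^sup>2..}" for t
  proof -
    have "0 < t" using that \<open>0 < b\<close> by (auto intro: less_le_trans[of 0 "b\<^sup>2"])
    have "((\<lambda>t. \<xi> (sqrt t)) has_real_derivative \<xi>' (sqrt t) * (inverse (sqrt t) / 2)) (at t)"
      using that deriv[of "sqrt t"] sqrt_ge \<open>0 < t\<close> by (intro DERIV_chain2 DERIV_real_sqrt) auto
    from DERIV_power[OF this, of 2] have "(\<sigma> has_real_derivative \<sigma>' t) (at t)"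
      by (simp add: \<sigma>_def [abs_def] \<sigma>'_def field_simps)
    then show ?thesis by (rule has_field_derivative_at_within)
  qed
  have inj_\<sigma>: "inj_on \<sigma> {b\<^sup>2..}"
  proof (rule inj_onI)
    fix t u assume *: "t \<in> {b\<^sup>2..}" "u \<in> {b\<^sup>2..}" "\<sigma> t = \<sigma> u"
    then have "\<xi> (sqrt t) = \<xi> (sqrt u)"
      using \<xi>_pos sqrt_ge by (auto simp: \<sigma>_def power2_eq_iff_nonneg less_imp_le)
    then have "sqrt t = sqrt u" using inj * sqrt_ge by (auto dest: inj_onD)
    then show "t = u" by simp
  qed
  have image_\<sigma>: "\<sigma> ` {b\<^sup>2..} = {(\<xi> b)\<^sup>2..}"
  proof (intro equalityI subsetI)
    fix u assume "u \<in> \<sigma> ` {b\<^sup>2..}"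
    then obtain t where t: "b\<^sup>2 \<le> t" "u = (\<xi> (sqrt t))\<^sup>2" by (auto simp: \<sigma>_def)
    then have "\<xi> b \<le> \<xi> (sqrt t)" using image sqrt_ge[of t] by auto
    then show "u \<in> {(\<xi> b)\<^sup>2..}" using t \<xi>_pos[of b] by (auto intro: power_mono)
  next
    fix u assume u: "u \<in> {(\<xi> b)\<^sup>2..}"
    then have "\<xi> b \<le> sqrt u" by (simp add: real_le_rsqrt)
    then have "sqrt u \<in> \<xi> ` {b..}" using image by simp
    then obtain y where y: "b \<le> y" "\<xi> y = sqrt u" by auto
    have "0 \<le> u" using u by (auto intro: order.trans[of 0 "(\<xi> b)\<^sup>2"])
    then have "u = \<sigma> (y\<^sup>2)" using y \<open>0 < b\<close> by (simp add: \<sigma>_def)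
    then show "u \<in> \<sigma> ` {b\<^sup>2..}" using y \<open>0 < b\<close> by (auto intro!: imageI power_mono)
  qed
  have cov: "(\<lambda>t. \<bar>\<sigma>' t\<bar> * ?G (\<sigma> t)) absolutely_integrable_on {b\<^sup>2..} \<and>
      integral {b\<^sup>2..} (\<lambda>t. \<bar>\<sigma>' t\<bar> * ?G (\<sigma> t)) = integral {(\<xi> b)\<^sup>2..} ?G"
    by (subst has_absolute_integral_change_of_variables_1'[OF _ der inj_\<sigma>]) (auto simp: image_\<sigma> int)
  have "(\<xi> b)\<^sup>2 \<le> b\<^sup>2" using \<open>\<xi> b \<le> b\<close> \<xi>_pos[of b] by (intro power_mono) auto
  then have int': "?G absolutely_integrable_on {b\<^sup>2..}"
    by (intro set_integrable_subset[OF int]) auto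
  have "c * integral {b\<^sup>2..} ?G = integral {b\<^sup>2..} (\<lambda>t. c * ?G t)" by simp
  also have "\<dots> \<le> integral {b\<^sup>2..} (\<lambda>t. q * (\<bar>\<sigma>' t\<bar> * ?G (\<sigma> t)))"
  proof (rule integral_le)
    show "(\<lambda>t. c * ?G t) integrable_on {b\<^sup>2..}"
      using int' by (intro integrable_on_mult_right absolutely_integrable_on_def[THEN iffD1, THEN conjunct1])
    show "(\<lambda>t. q * (\<bar>\<sigma>' t\<bar> * ?G (\<sigma> t))) integrable_on {b\<^sup>2..}"
      using cov by (intro integrable_on_mult_right absolutely_integrable_on_def[THEN iffD1, THEN conjunct1]) auto
    fix t assume "t \<in> {b\<^sup>2..}"
    then have t: "b\<^sup>2 \<le> t" by simp
    define y where "y = sqrt t"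
    have y: "b \<le> y" "0 < y" "t = y\<^sup>2"
      using sqrt_ge[OF t] less_le_trans[OF \<open>0 < b\<close> sqrt_ge[OF t]] order.trans[OF zero_le_power2 t]
      by (auto simp: y_def)
    have "c * ?G t = c * (y ^ (2 * n) * g (y\<^sup>2))" by (simp add: y power_mult)
    also have "\<dots> \<le> \<xi>' y * (\<xi> y / y) ^ (2 * n + 1) * (y ^ (2 * n) * g (y\<^sup>2))"
      using y g_nonneg lower by (intro mult_right_mono) auto
    also have "\<dots> = \<xi>' y * (\<xi> y / y) * (\<xi> y ^ (2 * n) * g (y\<^sup>2))"
      using y by (simp add: power_divide)
    also have "\<dots> \<le> \<xi>' y * (\<xi> y / y) * (\<xi> y ^ (2 * n) * (q * g ((\<xi> y)\<^sup>2)))"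
      using y decay \<xi>_pos[of y] \<xi>'_nonneg[of y] by (intro mult_left_mono) auto
    also have "\<dots> = q * (\<bar>\<sigma>' t\<bar> * ?G (\<sigma> t))"
      using y \<xi>_pos[of y] \<xi>'_nonneg[of y] by (simp add: \<sigma>_def \<sigma>'_def y_def [symmetric] power_mult)
    finally show "c * ?G t \<le> q * (\<bar>\<sigma>' t\<bar> * ?G (\<sigma> t))" .
  qed
  also have "\<dots> = q * integral {(\<xi> b)\<^sup>2..} ?G" using cov by simp
  finally show ?thesis .
qed

text \<open>
  Bernoulli's inequality for \<open>(\<xi> / y)^N = (1 - (y - \<xi>) / y)^N\<close>; the loss \<open>1 - \<xi>'\<close> enters additively since
  the power is at most \<open>1\<close>.
\<close>
lemma jacobian_power_lower_bound:
  fixes y \<xi> \<xi>' C \<epsilon> :: real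
  assumes "0 < y" "0 < \<xi>" "\<xi> \<le> y" "\<xi>' \<in> {0..1}" "y * (1 - \<xi>') \<le> C" "y - \<xi> \<le> C * ln y"
    and small: "C * (real N * ln y + 1) \<le> \<epsilon> * y"
  shows "1 - \<epsilon> \<le> \<xi>' * (\<xi> / y) ^ N"
proof -
  define r where "r = (\<xi> / y) ^ N"
  have r: "0 \<le> r" "r \<le> 1" using assms by (auto simp: r_def intro!: power_le_one)
  have "1 + real N * (- (y - \<xi>) / y) \<le> (1 + (- (y - \<xi>) / y)) ^ N"
    using assms by (intro Bernoulli_inequality) (auto simp: field_simps)
  also have "1 + (- (y - \<xi>) / y) = \<xi> / y" using assms by (simp add: field_simps)
  also have "real N * (- (y - \<xi>) / y) = - (real N * (y - \<xi>) / y)"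
    by (simp only: minus_divide_left [symmetric] mult_minus_right times_divide_eq_right)
  finally have "1 - real N * (y - \<xi>) / y \<le> r" by (simp add: r_def)
  moreover have "(1 - \<xi>') * r \<le> 1 - \<xi>'" using assms r by (intro mult_left_le) auto
  moreover have "real N * (y - \<xi>) / y + (1 - \<xi>') \<le> \<epsilon>"
  proof -
    have "real N * (y - \<xi>) \<le> real N * (C * ln y)" using assms by (intro mult_left_mono) auto
    with assms have "real N * (y - \<xi>) + y * (1 - \<xi>') \<le> \<epsilon> * y" by (simp add: algebra_simps)
    then have "(real N * (y - \<xi>) + y * (1 - \<xi>')) / y \<le> \<epsilon>" using assms by (simp add: divide_le_eq)
    then show ?thesis using assms by (simp add: add_divide_distrib)
  qed
  ultimately have "1 - \<epsilon> \<le> r - (1 - \<xi>') * r" by linarith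
  then show ?thesis by (simp add: r_def algebra_simps)
qed

text \<open>
  The tail beyond \<open>a\<^sup>2\<close> exceeds the tail beyond \<open>b\<^sup>2\<close> by at most the integral below \<open>b\<^sup>2\<close>, which is
  at most \<open>b^(2 n)\<close> because \<open>D\<close> has mass one. Together with the comparison this bounds the tail
  itself.
\<close>
lemma moment_bound_from_tail_comparison:
  fixes D :: "real measure"
  assumes D: "nonneg_distribution_with_moments D"
    and "0 < \<epsilon>" "0 < q" "q + 2 * \<epsilon> \<le> 1" "0 \<le> a" "a \<le> b"
    and tails: "(1 - \<epsilon>) * (LINT x:{b\<^sup>2..}|D. x ^ n) \<le> q * (LINT x:{a\<^sup>2..}|D. x ^ n)"
    and "1 \<le> n"
  shows "(LINT x|D. x ^ n) \<le> (1 + 1 / \<epsilon>) * b ^ (2 * n)"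
proof -
  interpret real_distribution D using D by (simp add: nonneg_distribution_with_moments_def)
  have int: "integrable D (\<lambda>x. x ^ n)" and nonneg: "AE x in D. 0 \<le> x"
    using D \<open>1 \<le> n\<close> by (auto simp: nonneg_distribution_with_moments_def)
  let ?T = "LINT x:{b\<^sup>2..}|D. x ^ n"
  have set_int: "integrable D (\<lambda>x. indicator A x * x ^ n)" if "A \<in> sets borel" for A
    using integrable_real_mult_indicator[OF _ int, of A] that by (simp add: mult.commute)
  have pow: "x ^ n \<le> b ^ (2 * n)" if "0 \<le> x" "x \<le> b\<^sup>2" for x
    using power_mono[OF that(2,1), of n] by (simp add: power_mult)
  have add: "(LINT x|D. indicator {b\<^sup>2..} x * x ^ n + b ^ (2 * n)) = ?T + b ^ (2 * n)"
    using set_int[of "{b\<^sup>2..}"] prob_space by (simp add: set_lebesgue_integral_def)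
  have whole: "(LINT x|D. x ^ n) \<le> ?T + b ^ (2 * n)"
    unfolding add [symmetric]
  proof (rule integral_mono_AE)
    show "AE x in D. x ^ n \<le> indicator {b\<^sup>2..} x * x ^ n + b ^ (2 * n)"
      using nonneg by eventually_elim (use pow in \<open>auto simp: indicator_def\<close>)
  qed (use int set_int in auto)
  have "(LINT x:{a\<^sup>2..}|D. x ^ n) \<le> (LINT x|D. x ^ n)"
    unfolding set_lebesgue_integral_def real_scaleR_def
  proof (rule integral_mono_AE)
    show "AE x in D. indicator {a\<^sup>2..} x * x ^ n \<le> x ^ n"
      using nonneg by eventually_elim (auto simp: indicator_def)
  qed (use int set_int in auto)
  with whole have "(LINT x:{a\<^sup>2..}|D. x ^ n) \<le> ?T + b ^ (2 * n)" by simp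
  then have "q * (LINT x:{a\<^sup>2..}|D. x ^ n) \<le> q * (?T + b ^ (2 * n))"
    using \<open>0 < q\<close> by simp
  with tails have "(1 - \<epsilon> - q) * ?T \<le> q * b ^ (2 * n)" by (simp add: algebra_simps)
  moreover have "0 \<le> ?T"
    unfolding set_lebesgue_integral_def using nonneg
    by (intro integral_nonneg_AE) (auto elim!: eventually_mono)
  then have "\<epsilon> * ?T \<le> (1 - \<epsilon> - q) * ?T" using assms by (intro mult_right_mono) auto
  moreover have "q * b ^ (2 * n) \<le> 1 * b ^ (2 * n)"
    using assms by (intro mult_right_mono) auto
  ultimately have "?T \<le> b ^ (2 * n) / \<epsilon>"
    using \<open>0 < \<epsilon>\<close> by (simp add: field_simps)
  with whole show ?thesis by (simp add: algebra_simps)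
qed

section \<open>Growth of the moments\<close>

lemma half_le_ln:
  fixes x :: real
  assumes "2 \<le> x"
  shows "1 / 2 \<le> ln x"
proof -
  have "ln (1 / 2) \<le> 1 / 2 - (1 :: real)" by (rule ln_le_minus_one) simp
  then have "1 / 2 \<le> ln (2 :: real)" by (simp add: ln_div)
  also have "\<dots> \<le> ln x" using assms by simp
  finally show ?thesis .
qed

text \<open>
  The terms dominate the increments of \<open>ln (ln n)\<close>.
\<close>
lemma not_summable_inverse_n_ln_n:
  "\<not> summable (\<lambda>n. 1 / (real (n + 2) * ln (real (n + 2))))"
proof
  let ?a = "\<lambda>n. 1 / (real (n + 2) * ln (real (n + 2)))"
  let ?f = "\<lambda>n. ln (ln (real (n + 2)))"
  assume summable: "summable ?a"
  have step: "?f (Suc n) - ?f n \<le> ?a n" for n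
  proof -
    define u where "u = real (n + 2)"
    have u: "2 \<le> u" by (simp add: u_def)
    have l: "0 < ln u" "0 < ln (u + 1)" using half_le_ln[of u] half_le_ln[of "u + 1"] u by linarith+
    have "?f (Suc n) - ?f n = ln (ln (u + 1) / ln u)"
      using l by (simp add: u_def ln_div add_ac)
    also have "\<dots> \<le> ln (u + 1) / ln u - 1"
      using l by (intro ln_le_minus_one) auto
    also have "\<dots> = ln ((u + 1) / u) / ln u"
      using l u by (simp add: ln_div field_simps)
    also have "\<dots> \<le> ((u + 1) / u - 1) / ln u"
      using l u by (intro divide_right_mono ln_le_minus_one) auto
    also have "\<dots> = 1 / (u * ln u)" using u by (simp add: field_simps)
    finally show ?thesis by (simp add: u_def)
  qed
  have nonneg: "0 \<le> ?a n" for n by simp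
  have bounded: "?f N \<le> suminf ?a + ?f 0" for N
  proof -
    have "?f N - ?f 0 = (\<Sum>n<N. ?f (Suc n) - ?f n)"
      by (rule sum_lessThan_telescope [symmetric])
    also have "\<dots> \<le> (\<Sum>n<N. ?a n)" by (rule sum_mono) (rule step)
    also have "\<dots> \<le> suminf ?a" using summable nonneg by (intro sum_le_suminf) auto
    finally show ?thesis by simp
  qed
  have "filterlim ?f at_top sequentially"
  proof -
    have "filterlim (\<lambda>n. real (n + 2)) at_top sequentially"
      by (rule filterlim_compose[OF filterlim_real_sequentially filterlim_add_const_nat_at_top])
    then show ?thesis by (intro filterlim_compose[OF ln_at_top])
  qed
  then obtain N where "suminf ?a + ?f 0 + 1 \<le> ?f N"
    unfolding filterlim_at_top eventually_sequentially by blast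
  with bounded[of N] show False by linarith
qed

text \<open>
  The scale beyond which the substitution costs little: since \<open>ln y / y\<close> decreases beyond \<open>e\<close>, it is
  enough to look at \<open>b = K N ln N\<close> with \<open>N = n + 2\<close>, where \<open>2 N C ln b / b\<close> is at most
  \<open>4 C (ln K + 1) / K\<close> uniformly in \<open>n\<close>. The offset \<open>2\<close> keeps the logarithm away from zero.
\<close>
lemma n_ln_n_scale:
  fixes B C \<epsilon> :: real
  assumes "0 < \<epsilon>" "0 < C"
  obtains K where "0 < K"
    "\<And>n. max B (exp 1) \<le> K * (real (n + 2) * ln (real (n + 2)))"
    "\<And>n y. K * (real (n + 2) * ln (real (n + 2))) \<le> y \<Longrightarrow>
      C * (real (2 * n + 1) * ln y + 1) \<le> \<epsilon> * y"
proof -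
  have "((\<lambda>K. 4 * C * (ln K / K + 1 / K)) \<longlongrightarrow> 4 * C * (0 + 0)) at_top"
    by (intro tendsto_intros ln_x_over_x_tendsto_0 tendsto_divide_0[OF tendsto_const] 
        filterlim_at_top_imp_at_infinity filterlim_ident)
  then have "\<forall>\<^sub>F K in at_top. 4 * C * (ln K / K + 1 / K) < \<epsilon>"
    using \<open>0 < \<epsilon>\<close> by (intro order_tendstoD) auto
  then have "\<forall>\<^sub>F K in at_top. max B (exp 1) \<le> K \<and> 4 * C * (ln K / K + 1 / K) < \<epsilon>"
    by (intro eventually_conj eventually_ge_at_top)
  then obtain K where K: "max B (exp 1) \<le> K" "4 * C * (ln K / K + 1 / K) < \<epsilon>"
    using eventually_happens trivial_limit_at_top_linorder by blast
  have "exp 1 \<le> K" using K by simp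
  then have K1: "1 \<le> K" "0 < K" using exp_gt_one[of 1] by (simp, smt (verit))+
  have scale: "K \<le> K * (real (n + 2) * ln (real (n + 2)))" for n
  proof -
    have "2 * (1 / 2) \<le> real (n + 2) * ln (real (n + 2))"
      by (intro mult_mono half_le_ln) auto
    then show ?thesis using K1 by (simp add: mult_le_cancel_left1)
  qed
  show ?thesis
  proof (rule that[of K])
    fix n y
    define N where "N = real (n + 2)"
    define L where "L = ln N"
    define b where "b = K * (N * L)"
    assume "K * (real (n + 2) * ln (real (n + 2))) \<le> y"
    then have y: "b \<le> y" by (simp add: b_def L_def N_def)
    have N: "2 \<le> N" by (simp add: N_def)
    then have L: "1 / 2 \<le> L" unfolding L_def by (rule half_le_ln)
    have "exp 1 \<le> b" using scale[of n] \<open>exp 1 \<le> K\<close> by (simp add: b_def L_def N_def)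
    then have pos: "0 < b" "0 < y" using y exp_gt_zero[of "1::real"] by linarith+
    have "ln (exp 1) \<le> ln y" using \<open>exp 1 \<le> b\<close> y pos by (subst ln_le_cancel_iff) auto
    then have ln_y: "1 \<le> ln y" by simp
    have "ln L \<le> L"
      using L ln_le_minus_one[of L] by simp
    then have ln_b: "ln b \<le> (2 * ln K + 2) * L"
    proof -
      have "ln b = ln K + (L + ln L)"
        using K1 N L by (simp add: b_def L_def ln_mult)
      also have "\<dots> \<le> ln K * (2 * L) + 2 * L"
      proof -
        have "ln K * 1 \<le> ln K * (2 * L)" using K1 L by (intro mult_left_mono) auto
        with \<open>ln L \<le> L\<close> show ?thesis by simp
      qed
      finally show ?thesis by (simp add: algebra_simps)
    qed
    have "C * (real (2 * n + 1) * ln y + 1) \<le> C * (2 * N * ln y)"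
    proof (rule mult_left_mono)
      have "real (2 * n + 1) * ln y + 1 \<le> real (2 * n + 1) * ln y + ln y" using ln_y by simp
      also have "\<dots> = (2 * N - 2) * ln y" by (simp add: N_def algebra_simps)
      also have "\<dots> \<le> 2 * N * ln y" using ln_y by (intro mult_right_mono) auto
      finally show "real (2 * n + 1) * ln y + 1 \<le> 2 * N * ln y" .
    qed (use \<open>0 < C\<close> in simp)
    also have "\<dots> = 2 * N * C * (ln y / y) * y" using pos by simp
    also have "\<dots> \<le> 2 * N * C * (ln b / b) * y"
      using \<open>exp 1 \<le> b\<close> y pos N \<open>0 < C\<close> by (intro mult_right_mono mult_left_mono ln_x_over_x_mono) auto
    also have "\<dots> \<le> 2 * N * C * ((2 * ln K + 2) * L / b) * y"
      using ln_b pos N \<open>0 < C\<close> by (intro mult_right_mono mult_left_mono divide_right_mono) auto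
    also have "2 * N * C * ((2 * ln K + 2) * L / b) = 4 * C * (ln K / K + 1 / K)"
      using N L K1 by (simp add: b_def field_simps)
    also have "4 * C * (ln K / K + 1 / K) * y \<le> \<epsilon> * y"
      using K(2) pos by (intro mult_right_mono) auto
    finally show "C * (real (2 * n + 1) * ln y + 1) \<le> \<epsilon> * y" .
  next
    show "max B (exp 1) \<le> K * (real (n + 2) * ln (real (n + 2)))" for n
      using K(1) scale[of n] by linarith
  qed (use K1 in simp)
qed

text \<open>
  With \<open>\<epsilon> = (1 - q) / 2\<close> the factor \<open>(1 - \<epsilon>) / q\<close> of the tail comparison stays above \<open>1\<close>.
\<close>
lemma moment_growth:
  assumes "0 < x0" and adm: "admissible_shift x0 \<phi>"
    and D: "nonneg_distribution_with_moments D" and dens: "has_density_from D x0 g"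
    and g_pos: "\<And>x. x0 \<le> x \<Longrightarrow> 0 < g x"
    and limsup: "Limsup at_top (\<lambda>x. ereal (g ((x + \<phi> x)\<^sup>2) / g (x\<^sup>2))) < 1"
  obtains A K where "1 \<le> A" "0 < K"
    "\<And>n. 1 \<le> n \<Longrightarrow> (LINT x|D. x ^ n) \<le> A * (K * (real (n + 2) * ln (real (n + 2)))) ^ (2 * n)"
proof (rule shift_inverse_eventually[OF assms(1) adm _ limsup])
  show "x0 \<le> x \<Longrightarrow> 0 < g x" for x by (rule g_pos)
next
  let ?\<xi> = "shift_inverse x0 \<phi>"
  fix B C q \<xi>'
  assume B: "exp 1 \<le> B" "x0 + \<phi> x0 \<le> B" and "0 < C" and q: "0 < q" "q < 1"
    and \<xi>: "\<And>y. B \<le> y \<Longrightarrow> (?\<xi> has_real_derivative \<xi>' y) (at y)"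
      "\<And>y. B \<le> y \<Longrightarrow> \<xi>' y \<in> {0..1}" "\<And>y. B \<le> y \<Longrightarrow> y * (1 - \<xi>' y) \<le> C"
      "\<And>y. B \<le> y \<Longrightarrow> 0 < ?\<xi> y" "\<And>y. B \<le> y \<Longrightarrow> ?\<xi> y \<le> y" "\<And>y. B \<le> y \<Longrightarrow> y - ?\<xi> y \<le> C * ln y"
      "\<And>y. B \<le> y \<Longrightarrow> x0 \<le> (?\<xi> y)\<^sup>2" "\<And>y. B \<le> y \<Longrightarrow> g (y\<^sup>2) \<le> q * g ((?\<xi> y)\<^sup>2)"
  define \<epsilon> where "\<epsilon> = (1 - q) / 2"
  have \<epsilon>: "0 < \<epsilon>" "q + 2 * \<epsilon> \<le> 1" using q by (simp_all add: \<epsilon>_def field_simps)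
  obtain K where K: "0 < K" "\<And>n. max B (exp 1) \<le> K * (real (n + 2) * ln (real (n + 2)))"
    "\<And>n y. K * (real (n + 2) * ln (real (n + 2))) \<le> y \<Longrightarrow>
      C * (real (2 * n + 1) * ln y + 1) \<le> \<epsilon> * y"
    using n_ln_n_scale[OF \<open>0 < \<epsilon>\<close> \<open>0 < C\<close>, of B] by metis
  have g_nonneg: "\<And>x. x0 \<le> x \<Longrightarrow> 0 \<le> g x" using g_pos less_imp_le by blast
  show ?thesis
  proof (rule that[of "1 + 1 / \<epsilon>" K])
    fix n :: nat assume "1 \<le> n"
    define b where "b = K * (real (n + 2) * ln (real (n + 2)))"
    have b: "B \<le> b" using K(2)[of n] by (simp add: b_def)
    then have "0 < b" using B(1) exp_gt_zero[of "1::real"] by linarith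
    have above: "B \<le> y" "0 < y" if "b \<le> y" for y using that b \<open>0 < b\<close> by auto
    have "?\<xi> b \<le> b" "0 < ?\<xi> b" using \<xi> b by auto
    have sq_le: "(?\<xi> b)\<^sup>2 \<le> b\<^sup>2" using \<open>?\<xi> b \<le> b\<close> \<open>0 < ?\<xi> b\<close> by (intro power_mono) auto
    have D': "real_distribution D" "integrable D (\<lambda>x. x ^ n)"
      using D \<open>1 \<le> n\<close> by (auto simp: nonneg_distribution_with_moments_def)
    note tail = density_tail_moment[OF D'(1) dens g_nonneg D'(2)]
    have "x0 + \<phi> x0 \<le> b" using B(2) b by simp
    have "(1 - \<epsilon>) * integral {b\<^sup>2..} (\<lambda>t. t ^ n * g t) \<le> q * integral {(?\<xi> b)\<^sup>2..} (\<lambda>t. t ^ n * g t)"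
    proof (rule tail_integral_comparison[OF \<open>0 < b\<close> q(1)])
      show "inj_on ?\<xi> {b..}"
        using shift_inverse_le_iff[OF adm] \<open>x0 + \<phi> x0 \<le> b\<close>
        by (intro inj_onI) (metis atLeast_iff order.antisym order.refl order.trans)
      show "?\<xi> ` {b..} = {?\<xi> b..}" by (rule shift_inverse_image[OF adm \<open>x0 + \<phi> x0 \<le> b\<close>])
      show "(\<lambda>t. t ^ n * g t) absolutely_integrable_on {(?\<xi> b)\<^sup>2..}"
        by (rule tail(1)) (use \<xi>(7)[OF b] in auto)
    next
      fix y assume y: "b \<le> y"
      note \<xi>y = \<xi>[OF above(1)[OF y]]
      show "(?\<xi> has_real_derivative \<xi>' y) (at y)" "0 \<le> \<xi>' y" "0 < ?\<xi> y" "g (y\<^sup>2) \<le> q * g ((?\<xi> y)\<^sup>2)"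
        using \<xi>y by auto
      have "(?\<xi> y)\<^sup>2 \<le> y\<^sup>2" using \<xi>y by (intro power_mono) auto
      then show "0 \<le> g (y\<^sup>2)" by (rule g_nonneg[OF order.trans[OF \<xi>y(7)]])
      show "1 - \<epsilon> \<le> \<xi>' y * (?\<xi> y / y) ^ (2 * n + 1)"
        using \<xi>y K(3)[of n y] y above(2)[OF y]
        by (intro jacobian_power_lower_bound[where C = C]) (auto simp: b_def)
    qed (rule \<open>?\<xi> b \<le> b\<close>)
    then have "(1 - \<epsilon>) * (LINT x:{b\<^sup>2..}|D. x ^ n) \<le> q * (LINT x:{(?\<xi> b)\<^sup>2..}|D. x ^ n)"
      using tail(2)[of "b\<^sup>2"] tail(2)[of "(?\<xi> b)\<^sup>2"] \<xi>(7)[OF b] sq_le by simp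
    from moment_bound_from_tail_comparison[OF D \<epsilon>(1) q(1) \<epsilon>(2) _ \<open>?\<xi> b \<le> b\<close> this \<open>1 \<le> n\<close>]
    show "(LINT x|D. x ^ n) \<le> (1 + 1 / \<epsilon>) * (K * (real (n + 2) * ln (real (n + 2)))) ^ (2 * n)"
      using \<open>0 < ?\<xi> b\<close> by (simp add: b_def)
  qed (use \<epsilon> K in auto)
qed

text \<open>
  The moments must be positive, since otherwise \<open>powr\<close> would turn them into zero terms.
\<close>
lemma carleman_condition_of_growth:
  fixes m :: "nat \<Rightarrow> real"
  assumes "1 \<le> A" "0 < K" and pos: "\<And>n. 1 \<le> n \<Longrightarrow> 0 < m n"
    and growth: "\<And>n. 1 \<le> n \<Longrightarrow> m n \<le> A * (K * (real (n + 2) * ln (real (n + 2)))) ^ (2 * n)"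
  shows "(\<Sum>n. ennreal (m (Suc n) powr (- 1 / (2 * real (Suc n))))) = \<infinity>"
proof (rule ccontr)
  assume "\<not> ?thesis"
  then have summable: "summable (\<lambda>n. m (Suc n) powr (- 1 / (2 * real (Suc n))))"
    by (intro summable_suminf_not_top) auto
  let ?a = "\<lambda>n. 1 / (real (n + 2) * ln (real (n + 2)))"
  have le: "?a (Suc n) \<le> A * K * m (Suc n) powr (- 1 / (2 * real (Suc n)))" for n
  proof -
    define b where "b = K * (real (Suc n + 2) * ln (real (Suc n + 2)))"
    define p where "p = 1 / (2 * real (Suc n))"
    have p: "0 < p" "p \<le> 1" by (auto simp: p_def)
    have "0 < b" using \<open>0 < K\<close> by (simp add: b_def)
    have "m (Suc n) powr p \<le> (A * b ^ (2 * Suc n)) powr p"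
      using growth[of "Suc n"] pos[of "Suc n"] p by (intro powr_mono2) (auto simp: b_def)
    also have "\<dots> = A powr p * b"
      using \<open>0 < b\<close> \<open>1 \<le> A\<close>
      by (simp add: powr_mult powr_realpow [symmetric] powr_powr p_def del: power_Suc)
    also have "\<dots> \<le> A * b"
      using p \<open>0 < b\<close> \<open>1 \<le> A\<close> powr_mono[of p 1 A] by (intro mult_right_mono) auto
    finally have "1 / (A * b) \<le> 1 / m (Suc n) powr p"
      using pos[of "Suc n"] by (intro divide_left_mono) (auto intro!: mult_pos_pos simp: \<open>0 < b\<close> less_le_trans[OF zero_less_one \<open>1 \<le> A\<close>])
    also have "\<dots> = m (Suc n) powr (- 1 / (2 * real (Suc n)))"
      by (simp add: p_def powr_minus_divide minus_divide_left [symmetric] del: of_nat_Suc)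
    finally have "A * K * (1 / (A * b)) \<le> A * K * m (Suc n) powr (- 1 / (2 * real (Suc n)))"
      using assms(1,2) by (intro mult_left_mono) auto
    moreover have "A * K * (1 / (A * b)) = ?a (Suc n)"
      using assms(1,2) by (simp add: b_def)
    ultimately show ?thesis by simp
  qed
  have "summable (\<lambda>n. ?a (Suc n))"
  proof (rule summable_comparison_test')
    show "summable (\<lambda>n. A * K * m (Suc n) powr (- 1 / (2 * real (Suc n))))"
      using summable by (rule summable_mult)
    show "norm (?a (Suc n)) \<le> A * K * m (Suc n) powr (- 1 / (2 * real (Suc n)))" if "0 \<le> n" for n
      using le[of n] by simp
  qed
  then have "summable ?a" by (subst (asm) summable_Suc_iff)
  then show False using not_summable_inverse_n_ln_n by simp
qed

text \<open>
  The density is positive on \<open>[x0, \<infinity>)\<close>, so \<open>D\<close> is not concentrated at \<open>0\<close>.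
\<close>
lemma moment_pos:
  assumes "0 < x0" and D: "nonneg_distribution_with_moments D" and dens: "has_density_from D x0 g"
    and g_pos: "\<And>x. x0 \<le> x \<Longrightarrow> 0 < g x" and "1 \<le> n"
  shows "0 < (LINT x|D. x ^ n)"
proof (rule ccontr)
  interpret real_distribution D using D by (simp add: nonneg_distribution_with_moments_def)
  have int: "integrable D (\<lambda>x. x ^ n)" and nonneg: "AE x in D. 0 \<le> x"
    using D \<open>1 \<le> n\<close> by (auto simp: nonneg_distribution_with_moments_def)
  have AE_pow: "AE x in D. 0 \<le> x ^ n" using nonneg by eventually_elim simp
  assume "\<not> ?thesis"
  then have "(LINT x|D. x ^ n) = 0" using integral_nonneg_AE[OF AE_pow] by simp
  then have "AE x in D. x ^ n = 0"
    using integral_nonneg_eq_0_iff_AE[OF int AE_pow] by simp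
  then have "AE x in D. x \<notin> {x0..}"
    by eventually_elim (use \<open>0 < x0\<close> in auto)
  then have "AE x in restrict_space D {x0..}. False"
    by (subst AE_restrict_space_iff) auto
  also have "restrict_space D {x0..} = density (restrict_space lborel {x0..}) (\<lambda>x. ennreal (g x))"
    using dens by (simp add: has_density_from_def)
  finally have "AE x in restrict_space lborel {x0..}. 0 < ennreal (g x) \<longrightarrow> False"
  proof (rule AE_density[THEN iffD1, rotated])
    have "g \<in> borel_measurable (restrict_space lborel {x0..})"
      using dens by (simp add: has_density_from_def cong: measurable_cong_sets restrict_space_sets_cong)
    then show "(\<lambda>x. ennreal (g x)) \<in> borel_measurable (restrict_space lborel {x0..})"
      by (rule measurable_compose[OF _ measurable_ennreal])
  qed
  moreover have "AE x in restrict_space lborel {x0..}. 0 < g x"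
    using g_pos by (intro AE_I2) (simp add: space_restrict_space)
  ultimately have "AE x in restrict_space lborel {x0..}. False" by eventually_elim simp
  then have "AE x in lborel. x \<notin> {x0..}"
    by (subst (asm) AE_restrict_space_iff) auto
  then have "emeasure lborel {x0..} = 0"
    by (subst (asm) AE_iff_measurable[of "{x0..}"]) auto
  moreover have "emeasure lborel {x0..x0 + 1} \<le> emeasure lborel {x0..}"
    by (intro emeasure_mono) auto
  ultimately show False by simp
qed

section \<open>The determinacy criterion\<close>

theorem theorem2:
  fixes M :: "'a measure" and Y :: "'a \<Rightarrow> real"
    and \<phi> g :: "real \<Rightarrow> real" and x0 :: real
  assumes "0 < x0"
    and "admissible_shift x0 \<phi>"
    and "prob_space M"
    and "Y \<in> borel_measurable M"
    and "\<And>\<omega>. \<omega> \<in> space M \<Longrightarrow> 0 \<le> Y \<omega>"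
    and "\<And>n::nat. 1 \<le> n \<Longrightarrow> integrable M (\<lambda>\<omega>. Y \<omega> ^ n)"
    and "has_density_from (distr M borel Y) x0 g"
    and "\<And>x. x0 \<le> x \<Longrightarrow> 0 < g x"
    and "((\<lambda>x. \<phi> x / x) \<longlongrightarrow> 0) at_top"
    and "Limsup at_top (\<lambda>x. ereal (g ((x + \<phi> x)\<^sup>2) / g (x\<^sup>2))) < 1"
  shows "(\<Sum>n. ennreal ((LINT \<omega>|M. Y \<omega> ^ Suc n) powr (- 1 / (2 * real (Suc n))))) = \<infinity>
       \<and> M_det_nonneg (distr M borel Y)"
proof -
  interpret prob_space M by fact
  note [measurable] = \<open>Y \<in> borel_measurable M\<close>
  let ?D = "distr M borel Y"
  have "real_distribution ?D" by (rule real_distribution_distr) fact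
  moreover have "AE x in ?D. 0 \<le> x"
    using assms(5) by (subst AE_distr_iff) auto
  moreover have "integrable ?D (\<lambda>x. x ^ n)" if "1 \<le> n" for n
    using assms(6)[OF that] by (subst integrable_distr_eq) auto
  ultimately have D: "nonneg_distribution_with_moments ?D"
    by (simp add: nonneg_distribution_with_moments_def)
  have moments: "(LINT x|?D. x ^ n) = (LINT \<omega>|M. Y \<omega> ^ n)" for n
    by (subst integral_distr) auto
  obtain A K where "1 \<le> A" "0 < K"
    and growth: "\<And>n. 1 \<le> n \<Longrightarrow>
      (LINT x|?D. x ^ n) \<le> A * (K * (real (n + 2) * ln (real (n + 2)))) ^ (2 * n)"
    using moment_growth[OF assms(1,2) D assms(7,8,10)] by metis
  then have carleman: "(\<Sum>n. ennreal ((LINT x|?D. x ^ Suc n) powr (- 1 / (2 * real (Suc n))))) = \<infinity>"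
    by (intro carleman_condition_of_growth[where m = "\<lambda>n. LINT x|?D. x ^ n"]
        moment_pos[OF assms(1) D assms(7,8)])
  then show ?thesis
    using carleman_imp_M_det[OF D carleman] by (simp only: moments simp_thms)
qed

end
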